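(* Let $A=KQ/I$ be a gentle algebra over an algebraically closed field $K$ whose quiver $Q$ is of type $\widetilde{\mathbb{A}}_n$, i.e. the underlying graph of $Q$ is a single cycle with $n$ vertices $1,\dots,n$ and $n$ edges (arbitrary orientation). Then the trivial extension $T(A)=A\ltimes DA$ is a Brauer cycle algebra if and only if $\mathrm{rad}^2 A=0$.
   Context: $D=\mathrm{Hom}_K(-,K)$; $T(A)$ has underlying space $A\oplus DA$ with multiplication $(a,f)(b,g)=(ab,ag+fb)$. Gentle: every vertex of $Q$ has at most two incoming and at most two outgoing arrows; for each arrow $\alpha$ there is at most one arrow $\beta$ with $\alpha\beta\in I$, at most one $\gamma$ with $\gamma\alpha\in I$, at most one $\beta'$ with $\alpha\beta'\notin I$ and at most one $\gamma'$ with $\gamma'\alpha\notin I$ (composable arrows); $I$ is admissible and generated by paths of length 2. A Brauer cycle algebra is the Brauer graph algebra, with all multiplicities equal to $1$, of a graph $G$ that is a cycle with $n$ edges; concretely it is $KQ'/I'$ where $Q'$ has vertices $1,\dots,n$ (indices mod $n$), arrows $\alpha_i:i\to i+1$ and $\beta_i:i+1\to i$, and $I'=\langle \alpha_i\alpha_{i+1},\ \beta_{i+1}\beta_i,\ \beta_i\alpha_i-\alpha_{i+1}\beta_{i+1}\ (\text{all } i \bmod n)\rangle$. *)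

theory Defs
  imports "HOL-Algebra.QuotRing" "HOL-Computational_Algebra.Polynomial"
begin

definition alg_closed :: "'k::field itself \<Rightarrow> bool" where
  "alg_closed _ \<longleftrightarrow> (\<forall>p::'k poly. degree p > 0 \<longrightarrow> (\<exists>x. poly p x = 0))"

record ('v, 'a) quiver =
  verts :: "'v set"
  arrs  :: "'a set"
  src   :: "'a \<Rightarrow> 'v"
  tgt   :: "'a \<Rightarrow> 'v"

text \<open>A path is a pair (start vertex, list of arrows); arrows are composed left to right,
  i.e. the path [a,b] means first a then b (as in the relations of the Brauer cycle algebra).\<close>

fun is_path :: "('v, 'a, 'm) quiver_scheme \<Rightarrow> 'v \<times> 'a list \<Rightarrow> bool" where
  "is_path Q (v, []) \<longleftrightarrow> v \<in> verts Q"
| "is_path Q (v, a # xs) \<longleftrightarrow> v \<in> verts Q \<and> a \<in> arrs Q \<and> src Q a = v \<and> is_path Q (tgt Q a, xs)"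

definition path_end :: "('v, 'a, 'm) quiver_scheme \<Rightarrow> 'v \<times> 'a list \<Rightarrow> 'v" where
  "path_end Q p = (if snd p = [] then fst p else tgt Q (last (snd p)))"

definition path_alg :: "('v, 'a, 'm) quiver_scheme \<Rightarrow> ('v \<times> 'a list \<Rightarrow> 'k::field) ring" where
  "path_alg Q =
    \<lparr> carrier = {f. finite {x. f x \<noteq> 0} \<and> (\<forall>x. f x \<noteq> 0 \<longrightarrow> is_path Q x)},
      monoid.mult = (\<lambda>f g p. if is_path Q p then
                 (\<Sum>k\<in>{0..length (snd p)}.
                    f (fst p, take k (snd p)) * g (path_end Q (fst p, take k (snd p)), drop k (snd p)))
               else 0),
      monoid.one = (\<lambda>p. if snd p = [] \<and> fst p \<in> verts Q then 1 else 0),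
      ring.zero = (\<lambda>_. 0),
      ring.add = (\<lambda>f g p. f p + g p) \<rparr>"

definition path_basis :: "'v \<times> 'a list \<Rightarrow> ('v \<times> 'a list \<Rightarrow> 'k::field)" where
  "path_basis q = (\<lambda>p. if p = q then 1 else 0)"

definition path_iota :: "('v, 'a, 'm) quiver_scheme \<Rightarrow> 'k::field \<Rightarrow> ('v \<times> 'a list \<Rightarrow> 'k)" where
  "path_iota Q c = (\<lambda>p. c * \<one>\<^bsub>path_alg Q\<^esub> p)"

definition arrow_ideal_pow :: "('v, 'a, 'm) quiver_scheme \<Rightarrow> nat \<Rightarrow> ('v \<times> 'a list \<Rightarrow> 'k::field) set" where
  "arrow_ideal_pow Q m = {f \<in> carrier (path_alg Q). \<forall>x. f x \<noteq> 0 \<longrightarrow> length (snd x) \<ge> m}"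

definition admissible :: "('v, 'a, 'm) quiver_scheme \<Rightarrow> ('v \<times> 'a list \<Rightarrow> 'k::field) set \<Rightarrow> bool" where
  "admissible Q I \<longleftrightarrow> ideal I (path_alg Q) \<and> I \<subseteq> arrow_ideal_pow Q 2 \<and>
     (\<exists>m\<ge>2. arrow_ideal_pow Q m \<subseteq> I)"

definition bound_alg :: "('v, 'a, 'm) quiver_scheme \<Rightarrow> ('v \<times> 'a list \<Rightarrow> 'k::field) set
    \<Rightarrow> ('v \<times> 'a list \<Rightarrow> 'k) set ring" where
  "bound_alg Q I = path_alg Q Quot I"

definition bound_iota :: "('v, 'a, 'm) quiver_scheme \<Rightarrow> ('v \<times> 'a list \<Rightarrow> 'k::field) set
    \<Rightarrow> 'k \<Rightarrow> ('v \<times> 'a list \<Rightarrow> 'k) set" where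
  "bound_iota Q I c = a_r_coset (path_alg Q) I (path_iota Q c)"

definition composable :: "('v, 'a, 'm) quiver_scheme \<Rightarrow> 'a \<Rightarrow> 'a \<Rightarrow> bool" where
  "composable Q a b \<longleftrightarrow> a \<in> arrs Q \<and> b \<in> arrs Q \<and> tgt Q a = src Q b"

definition len2_path :: "('v, 'a, 'm) quiver_scheme \<Rightarrow> 'a \<times> 'a \<Rightarrow> ('v \<times> 'a list \<Rightarrow> 'k::field)" where
  "len2_path Q r = path_basis (src Q (fst r), [fst r, snd r])"

definition gentle :: "('v, 'a, 'm) quiver_scheme \<Rightarrow> ('v \<times> 'a list \<Rightarrow> 'k::field) set \<Rightarrow> bool" where
  "gentle Q I \<longleftrightarrow>
     finite (verts Q) \<and> finite (arrs Q) \<and>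
     (\<forall>a\<in>arrs Q. src Q a \<in> verts Q \<and> tgt Q a \<in> verts Q) \<and>
     (\<forall>v\<in>verts Q. card {a\<in>arrs Q. tgt Q a = v} \<le> 2 \<and> card {a\<in>arrs Q. src Q a = v} \<le> 2) \<and>
     admissible Q I \<and>
     (\<exists>R. R \<subseteq> {(a, b). composable Q a b} \<and>
          I = genideal (path_alg Q) (len2_path Q ` R) \<and>
          (\<forall>\<alpha>\<in>arrs Q.
             (\<forall>\<beta>1 \<beta>2. (\<alpha>, \<beta>1) \<in> R \<and> (\<alpha>, \<beta>2) \<in> R \<longrightarrow> \<beta>1 = \<beta>2) \<and>
             (\<forall>\<gamma>1 \<gamma>2. (\<gamma>1, \<alpha>) \<in> R \<and> (\<gamma>2, \<alpha>) \<in> R \<longrightarrow> \<gamma>1 = \<gamma>2) \<and>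
             (\<forall>\<beta>1 \<beta>2. composable Q \<alpha> \<beta>1 \<and> (\<alpha>, \<beta>1) \<notin> R \<and>
                       composable Q \<alpha> \<beta>2 \<and> (\<alpha>, \<beta>2) \<notin> R \<longrightarrow> \<beta>1 = \<beta>2) \<and>
             (\<forall>\<gamma>1 \<gamma>2. composable Q \<gamma>1 \<alpha> \<and> (\<gamma>1, \<alpha>) \<notin> R \<and>
                       composable Q \<gamma>2 \<alpha> \<and> (\<gamma>2, \<alpha>) \<notin> R \<longrightarrow> \<gamma>1 = \<gamma>2)))"

definition cycle_quiver :: "('v, 'a, 'm) quiver_scheme \<Rightarrow> nat \<Rightarrow> bool" where
  "cycle_quiver Q n \<longleftrightarrow>
     (\<exists>c e. bij_betw c {0..<n} (verts Q) \<and> bij_betw e {0..<n} (arrs Q) \<and>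
        (\<forall>i<n. (src Q (e i), tgt Q (e i)) = (c i, c (Suc i mod n)) \<or>
               (src Q (e i), tgt Q (e i)) = (c (Suc i mod n), c i)))"

definition left_ideal :: "('r, 'm) ring_scheme \<Rightarrow> 'r set \<Rightarrow> bool" where
  "left_ideal R L \<longleftrightarrow> L \<subseteq> carrier R \<and> \<zero>\<^bsub>R\<^esub> \<in> L \<and>
     (\<forall>x\<in>L. \<forall>y\<in>L. x \<oplus>\<^bsub>R\<^esub> y \<in> L) \<and> (\<forall>x\<in>L. \<ominus>\<^bsub>R\<^esub> x \<in> L) \<and>
     (\<forall>r\<in>carrier R. \<forall>x\<in>L. r \<otimes>\<^bsub>R\<^esub> x \<in> L)"

definition maximal_left_ideal :: "('r, 'm) ring_scheme \<Rightarrow> 'r set \<Rightarrow> bool" where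
  "maximal_left_ideal R L \<longleftrightarrow> left_ideal R L \<and> L \<noteq> carrier R \<and>
     (\<forall>L'. left_ideal R L' \<and> L \<subseteq> L' \<and> L' \<noteq> carrier R \<longrightarrow> L' = L)"

definition jacobson_rad :: "('r, 'm) ring_scheme \<Rightarrow> 'r set" where
  "jacobson_rad R = carrier R \<inter> \<Inter>{L. maximal_left_ideal R L}"

section \<open>K-algebras given as (ring, structure map K \<rightarrow> ring); trivial extension\<close>

definition kdual :: "('r, 'm) ring_scheme \<Rightarrow> ('k::field \<Rightarrow> 'r) \<Rightarrow> ('r \<Rightarrow> 'k) set" where
  "kdual R \<iota> = {f. (\<forall>x\<in>carrier R. \<forall>y\<in>carrier R. f (x \<oplus>\<^bsub>R\<^esub> y) = f x + f y) \<and>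
                   (\<forall>c. \<forall>x\<in>carrier R. f (\<iota> c \<otimes>\<^bsub>R\<^esub> x) = c * f x) \<and>
                   (\<forall>x. x \<notin> carrier R \<longrightarrow> f x = 0)}"

text \<open>T(A) = A \<oplus> DA with (a,f)(b,g) = (ab, ag + fb), where (ag)(x) = g(xa), (fb)(x) = f(bx).\<close>
definition triv_ext :: "('r, 'm) ring_scheme \<Rightarrow> ('k::field \<Rightarrow> 'r) \<Rightarrow> ('r \<times> ('r \<Rightarrow> 'k)) ring" where
  "triv_ext R \<iota> =
    \<lparr> carrier = carrier R \<times> kdual R \<iota>,
      monoid.mult = (\<lambda>(a, f) (b, g). (a \<otimes>\<^bsub>R\<^esub> b,
                 \<lambda>x. if x \<in> carrier R then g (x \<otimes>\<^bsub>R\<^esub> a) + f (b \<otimes>\<^bsub>R\<^esub> x) else 0)),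
      monoid.one = (\<one>\<^bsub>R\<^esub>, \<lambda>_. 0),
      ring.zero = (\<zero>\<^bsub>R\<^esub>, \<lambda>_. 0),
      ring.add = (\<lambda>(a, f) (b, g). (a \<oplus>\<^bsub>R\<^esub> b, \<lambda>x. f x + g x)) \<rparr>"

definition triv_ext_iota :: "('k::field \<Rightarrow> 'r) \<Rightarrow> 'k \<Rightarrow> 'r \<times> ('r \<Rightarrow> 'k)" where
  "triv_ext_iota \<iota> c = (\<iota> c, \<lambda>_. 0)"

definition alg_iso :: "('r, 'm) ring_scheme \<Rightarrow> ('k \<Rightarrow> 'r) \<Rightarrow> ('s, 'n) ring_scheme \<Rightarrow> ('k \<Rightarrow> 's) \<Rightarrow> bool" where
  "alg_iso R \<iota>R S \<iota>S \<longleftrightarrow> (\<exists>\<phi>. \<phi> \<in> ring_iso R S \<and> (\<forall>c. \<phi> (\<iota>R c) = \<iota>S c))"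

text \<open>Quiver Q' with vertices 0..m-1 (indices mod m); (True,i) is alpha_i : i \<rightarrow> i+1,
  (False,i) is beta_i : i+1 \<rightarrow> i.\<close>
definition brauer_quiver :: "nat \<Rightarrow> (nat, bool \<times> nat) quiver" where
  "brauer_quiver m =
    \<lparr> verts = {0..<m}, arrs = UNIV \<times> {0..<m},
      src = (\<lambda>(b, i). if b then i else Suc i mod m),
      tgt = (\<lambda>(b, i). if b then Suc i mod m else i) \<rparr>"

definition brauer_rels :: "nat \<Rightarrow> (nat \<times> (bool \<times> nat) list \<Rightarrow> 'k::field) set" where
  "brauer_rels m = (\<Union>i\<in>{0..<m}. let j = Suc i mod m in
     { path_basis (i, [(True, i), (True, j)]),
       path_basis (Suc j mod m, [(False, j), (False, i)]),
       (\<lambda>p. path_basis (j, [(False, i), (True, i)]) p - path_basis (j, [(True, j), (False, j)]) p) })"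

definition brauer_ideal :: "nat \<Rightarrow> (nat \<times> (bool \<times> nat) list \<Rightarrow> 'k::field) set" where
  "brauer_ideal m = genideal (path_alg (brauer_quiver m)) (brauer_rels m)"

definition brauer_cycle_alg :: "nat \<Rightarrow> (nat \<times> (bool \<times> nat) list \<Rightarrow> 'k::field) set ring" where
  "brauer_cycle_alg m = bound_alg (brauer_quiver m) (brauer_ideal m)"

definition brauer_cycle_iota :: "nat \<Rightarrow> 'k::field \<Rightarrow> (nat \<times> (bool \<times> nat) list \<Rightarrow> 'k) set" where
  "brauer_cycle_iota m = bound_iota (brauer_quiver m) (brauer_ideal m)"

definition is_brauer_cycle_alg :: "('r, 'm) ring_scheme \<Rightarrow> ('k::field \<Rightarrow> 'r) \<Rightarrow> bool" where
  "is_brauer_cycle_alg R \<iota> \<longleftrightarrow>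
     (\<exists>m\<ge>1. alg_iso R \<iota> (brauer_cycle_alg m :: (nat \<times> (bool \<times> nat) list \<Rightarrow> 'k) set ring)
                        (brauer_cycle_iota m))"

end

theory Submission
  imports Defs "HOL-Computational_Algebra.Formal_Power_Series" "HOL-Library.Function_Algebras"
begin

text \<open>Modulo its relations, every path of length three of the Brauer quiver is zero, so the Brauer
  cycle algebra has vanishing radical cube. If the trivial extension \<open>T\<close> of \<open>A\<close> is isomorphic to
  it, then for \<open>a, b\<close> in the radical of \<open>A\<close> and \<open>g\<close> in the dual of \<open>A\<close> the elements
  \<open>(a, 0), (b, 0), (0, g)\<close> are nilpotent, hence are mapped into the arrow ideal, and their product
  vanishes. Its dual component at 1 is \<open>g (a b)\<close>, and linear functionals separate points, so \<open>a b = 0\<close>.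

  Conversely, if the radical of \<open>A\<close> squares to zero, then \<open>I\<close> is the square of the arrow ideal and
  \<open>A\<close> has the vertices and arrows as a basis. Each edge of the cycle carries one arrow of \<open>Q\<close>, and its
  dual basis vector serves as the arrow of the Brauer quiver in the opposite direction; the dual
  basis vectors of the vertices are the socle elements. This gives a surjection from the path algebra
  of the Brauer quiver onto \<open>T\<close> whose kernel is the Brauer ideal.\<close>

section \<open>Path algebras\<close>

text \<open>Nilpotency is what crosses the isomorphism in the first direction: ring homomorphisms
  preserve it, and when the relations lie in the arrow ideal, a nilpotent class has coefficient zero
  at every trivial path. For the converse, let a be an arrow from u to w, so that a = e_u a e_w, and
  mark dual basis vectors by a prime. The formulas (ag)(x) = g(xa) and (fb)(x) = f(bx) give a' = e_w
  a' e_u, hence a' runs from w back to u. They also give a a' = e_u' and a' a = e_w'. Thus the two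
  edge ends meeting at a vertex produce two cycles with the same value in the socle, which is the
  commutativity relation. The monomial relations hold since two arrows multiply to zero in A, two
  dual elements multiply to zero in T, and an arrow and the dual of a different arrow multiply to
  zero. Nothing here depends on the orientation of an edge, which only decides whether alpha or beta
  is the genuine arrow. Indices are read mod n, so the loop (n = 1) and the double edge (n = 2) are
  no special cases.\<close>

lemma path_end_Nil [simp]: "path_end Q (v, []) = v"
  by (simp add: path_end_def)

lemma path_end_Cons [simp]: "path_end Q (v, a # xs) = path_end Q (tgt Q a, xs)"
  by (simp add: path_end_def)

lemma is_path_append:
  "is_path Q (v, xs @ ys) \<longleftrightarrow> is_path Q (v, xs) \<and> is_path Q (path_end Q (v, xs), ys)"
proof (induction xs arbitrary: v)
  case Nil
  then show ?case by (cases ys) auto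
qed auto

lemma path_end_append: "path_end Q (v, xs @ ys) = path_end Q (path_end Q (v, xs), ys)"
  by (induction xs arbitrary: v) auto

lemma path_end_in_verts: "is_path Q (v, xs) \<Longrightarrow> path_end Q (v, xs) \<in> verts Q"
  by (induction xs arbitrary: v) auto

lemma is_path_start: "is_path Q p \<Longrightarrow> fst p \<in> verts Q"
  by (cases p; cases "snd p") auto

lemma path_alg_carrier_iff:
  "f \<in> carrier (path_alg Q) \<longleftrightarrow> finite {x. f x \<noteq> 0} \<and> (\<forall>x. f x \<noteq> 0 \<longrightarrow> is_path Q x)"
  by (simp add: path_alg_def)

lemma path_alg_zero [simp]: "\<zero>\<^bsub>path_alg Q\<^esub> = (\<lambda>_. 0)"
  by (simp add: path_alg_def)

lemma path_alg_add [simp]: "f \<oplus>\<^bsub>path_alg Q\<^esub> g = (\<lambda>p. f p + g p)"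
  by (simp add: path_alg_def)

lemma path_alg_one: "\<one>\<^bsub>path_alg Q\<^esub> = (\<lambda>p. if snd p = [] \<and> fst p \<in> verts Q then 1 else 0)"
  by (simp add: path_alg_def)

text \<open>A list is a path exactly if both pieces of any split are paths with matching ends. For
  factors supported on paths, every split of a non-path therefore has a zero factor, and the guard
  in the definition of the product disappears.\<close>

lemma path_alg_mult:
  assumes "f \<in> carrier (path_alg Q)" "g \<in> carrier (path_alg Q)"
  shows "(f \<otimes>\<^bsub>path_alg Q\<^esub> g) (v, xs) =
    (\<Sum>k=0..length xs. f (v, take k xs) * g (path_end Q (v, take k xs), drop k xs))"
proof (cases "is_path Q (v, xs)")
  case False
  have "f (v, take k xs) * g (path_end Q (v, take k xs), drop k xs) = 0" for k
    using assms False is_path_append[of Q v "take k xs" "drop k xs"]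
    by (auto simp: path_alg_carrier_iff)
  then have "(\<Sum>k=0..length xs. f (v, take k xs) * g (path_end Q (v, take k xs), drop k xs)) = 0"
    by (intro sum.neutral) blast
  then show ?thesis using False by (simp add: path_alg_def)
qed (simp add: path_alg_def)

lemma path_alg_mult_nil:
  assumes "f \<in> carrier (path_alg Q)" "g \<in> carrier (path_alg Q)"
  shows "(f \<otimes>\<^bsub>path_alg Q\<^esub> g) (v, []) = f (v, []) * g (v, [])"
  using assms by (simp add: path_alg_mult)

lemma path_alg_mult_arrow:
  assumes "f \<in> carrier (path_alg Q)" "g \<in> carrier (path_alg Q)"
  shows "(f \<otimes>\<^bsub>path_alg Q\<^esub> g) (v, [a]) = f (v, []) * g (v, [a]) + f (v, [a]) * g (tgt Q a, [])"
  using assms by (simp add: path_alg_mult)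

lemma path_alg_mult_arrow2:
  assumes "f \<in> carrier (path_alg Q)" "g \<in> carrier (path_alg Q)"
  shows "(f \<otimes>\<^bsub>path_alg Q\<^esub> g) (v, [a, b]) =
    f (v, []) * g (v, [a, b]) + f (v, [a]) * g (tgt Q a, [b]) + f (v, [a, b]) * g (tgt Q b, [])"
  using assms by (simp add: path_alg_mult numeral_2_eq_2)

lemma path_alg_mult_nonzeroE:
  assumes "f \<in> carrier (path_alg Q)" "g \<in> carrier (path_alg Q)"
    and "(f \<otimes>\<^bsub>path_alg Q\<^esub> g) (v, xs) \<noteq> 0"
  obtains k where "k \<le> length xs" "f (v, take k xs) \<noteq> 0"
    "g (path_end Q (v, take k xs), drop k xs) \<noteq> 0"
proof -
  have "(\<Sum>k=0..length xs. f (v, take k xs) * g (path_end Q (v, take k xs), drop k xs)) \<noteq> 0"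
    using assms(3) by (simp only: path_alg_mult[OF assms(1,2)] not_False_eq_True)
  from sum.not_neutral_contains_not_neutral[OF this] that show ?thesis by auto
qed

lemma path_alg_add_closed:
  assumes "f \<in> carrier (path_alg Q)" "g \<in> carrier (path_alg Q)"
  shows "(\<lambda>p. f p + g p) \<in> carrier (path_alg Q)"
proof -
  have "{x. f x + g x \<noteq> 0} \<subseteq> {x. f x \<noteq> 0} \<union> {x. g x \<noteq> 0}" by auto
  then have "finite {x. f x + g x \<noteq> 0}"
    using assms by (auto simp: path_alg_carrier_iff intro: finite_subset)
  then show ?thesis using assms by (simp add: path_alg_carrier_iff) (metis add_0)
qed

lemma path_alg_scale_closed:
  assumes "f \<in> carrier (path_alg Q)"
  shows "(\<lambda>p. c * f p) \<in> carrier (path_alg Q)"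
proof -
  have "{x. c * f x \<noteq> 0} \<subseteq> {x. f x \<noteq> 0}" by auto
  then have "finite {x. c * f x \<noteq> 0}"
    using assms by (auto simp: path_alg_carrier_iff intro: finite_subset)
  then show ?thesis using assms by (auto simp: path_alg_carrier_iff)
qed

lemma path_alg_mult_closed:
  assumes "f \<in> carrier (path_alg Q)" "g \<in> carrier (path_alg Q)"
  shows "f \<otimes>\<^bsub>path_alg Q\<^esub> g \<in> carrier (path_alg Q)"
proof -
  let ?S = "(\<lambda>(p, q). (fst p, snd p @ snd q)) ` ({x. f x \<noteq> 0} \<times> {x. g x \<noteq> 0})"
  have "p \<in> ?S" if nz: "(f \<otimes>\<^bsub>path_alg Q\<^esub> g) p \<noteq> 0" for p
  proof -
    obtain v xs where p: "p = (v, xs)" by (cases p)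
    with path_alg_mult_nonzeroE[OF assms] nz obtain k where
      "f (v, take k xs) \<noteq> 0" "g (path_end Q (v, take k xs), drop k xs) \<noteq> 0"
      by blast
    then show ?thesis using p
      by (intro image_eqI[of _ _ "((v, take k xs), (path_end Q (v, take k xs), drop k xs))"]) auto
  qed
  then have "{p. (f \<otimes>\<^bsub>path_alg Q\<^esub> g) p \<noteq> 0} \<subseteq> ?S" by auto
  moreover have "finite ?S" using assms by (auto simp: path_alg_carrier_iff)
  ultimately have "finite {p. (f \<otimes>\<^bsub>path_alg Q\<^esub> g) p \<noteq> 0}" by (rule finite_subset)
  moreover have "is_path Q p" if "(f \<otimes>\<^bsub>path_alg Q\<^esub> g) p \<noteq> 0" for p
    using that by (auto simp: path_alg_def split: if_splits)
  ultimately show ?thesis by (simp add: path_alg_carrier_iff)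
qed

lemma path_alg_scaled_one_closed:
  assumes "finite (verts Q)"
  shows "path_iota Q c \<in> carrier (path_alg Q)"
proof -
  have "{x. path_iota Q c x \<noteq> 0} \<subseteq> (\<lambda>v. (v, [])) ` verts Q"
    by (auto simp: path_iota_def path_alg_one split: if_splits)
  then have "finite {x. path_iota Q c x \<noteq> 0}" using assms by (auto intro: finite_subset)
  then show ?thesis
    by (auto simp: path_alg_carrier_iff path_iota_def path_alg_one split: if_splits)
qed

lemma path_iota_1: "path_iota Q 1 = \<one>\<^bsub>path_alg Q\<^esub>"
  by (simp add: path_iota_def)

text \<open>The scaled identity is supported on trivial paths, so only the split at one end
  contributes. Through this identity, closure of an ideal under ring multiplication yields closure
  under scalars.\<close>

lemma path_iota_mult:
  fixes Q :: "('v, 'a, 'm) quiver_scheme"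
  assumes "finite (verts Q)" "f \<in> carrier (path_alg Q)"
  shows "path_iota Q c \<otimes>\<^bsub>path_alg Q\<^esub> f = (\<lambda>p. c * f p)" (is "?L = _")
    and "f \<otimes>\<^bsub>path_alg Q\<^esub> path_iota Q c = (\<lambda>p. c * f p)" (is "?R = _")
proof -
  show "?L = (\<lambda>p. c * f p)"
  proof
    fix p :: "'v \<times> 'a list"
    obtain v xs where p: "p = (v, xs)" by (cases p)
    have "?L p = (\<Sum>k=0..length xs. if k = 0 then c * (if v \<in> verts Q then f (v, xs) else 0) else 0)"
      unfolding p path_alg_mult[OF path_alg_scaled_one_closed[OF assms(1)] assms(2)]
      by (rule sum.cong) (auto simp: path_iota_def path_alg_one)
    also have "\<dots> = c * f p"
      using assms(2) is_path_start[of Q p] by (auto simp: p path_alg_carrier_iff)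
    finally show "?L p = c * f p" .
  qed
  show "?R = (\<lambda>p. c * f p)"
  proof
    fix p :: "'v \<times> 'a list"
    obtain v xs where p: "p = (v, xs)" by (cases p)
    have "?R p = (\<Sum>k=0..length xs. if k = length xs
        then c * (if path_end Q (v, xs) \<in> verts Q then f (v, xs) else 0) else 0)"
      unfolding p path_alg_mult[OF assms(2) path_alg_scaled_one_closed[OF assms(1)]]
      by (rule sum.cong) (auto simp: path_iota_def path_alg_one)
    also have "\<dots> = c * f p"
      using assms(2) path_end_in_verts[of Q v xs] by (auto simp: p path_alg_carrier_iff)
    finally show "?R p = c * f p" .
  qed
qed

lemma path_alg_assoc:
  fixes Q :: "('v, 'a, 'm) quiver_scheme"
  assumes f: "f \<in> carrier (path_alg Q)" and g: "g \<in> carrier (path_alg Q)"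
    and h: "h \<in> carrier (path_alg Q)"
  shows "f \<otimes>\<^bsub>path_alg Q\<^esub> g \<otimes>\<^bsub>path_alg Q\<^esub> h = f \<otimes>\<^bsub>path_alg Q\<^esub> (g \<otimes>\<^bsub>path_alg Q\<^esub> h)" (is "?L = ?R")
proof
  fix p :: "'v \<times> 'a list"
  obtain v xs where p: "p = (v, xs)" by (cases p)
  \<comment> \<open>\<open>F\<close> is indexed by the lengths of the three pieces of
    \<open>xs\<close>, the shape in which the associativity lemma for products of power series
    reindexes the double sum.\<close>
  define F where "F i j r = f (v, take i xs) * g (path_end Q (v, take i xs), take j (drop i xs))
    * h (path_end Q (v, take (i + j) xs), drop (i + j) xs)" for i j r :: nat
  have "?L p = (\<Sum>k=0..length xs. \<Sum>i=0..k. F i (k - i) (length xs - k))"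
    unfolding p path_alg_mult[OF path_alg_mult_closed[OF f g] h] path_alg_mult[OF f g]
    by (intro sum.cong refl)
      (auto simp: F_def sum_distrib_right take_drop min_def intro!: sum.cong)
  also have "\<dots> = (\<Sum>k=0..length xs. \<Sum>i=0..length xs - k. F k i (length xs - k - i))"
    by (rule fps_mult_assoc_lemma)
  also have "\<dots> = ?R p"
    unfolding p path_alg_mult[OF f path_alg_mult_closed[OF g h]] path_alg_mult[OF g h]
    by (intro sum.cong refl)
      (auto simp: F_def sum_distrib_left take_add path_end_append mult.assoc add.commute
        intro!: sum.cong)
  finally show "?L p = ?R p" .
qed

lemma path_alg_ring:
  assumes fin: "finite (verts Q)"
  shows "ring (path_alg Q :: ('v \<times> 'a list \<Rightarrow> 'k::field) ring)" (is "ring ?P")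
proof (rule ringI)
  show "abelian_group ?P"
  proof (rule abelian_groupI)
    fix f :: "'v \<times> 'a list \<Rightarrow> 'k" assume "f \<in> carrier ?P"
    then show "\<exists>g\<in>carrier ?P. g \<oplus>\<^bsub>?P\<^esub> f = \<zero>\<^bsub>?P\<^esub>"
      using path_alg_scale_closed[of f Q "-1"] by (auto intro!: bexI[of _ "\<lambda>p. - f p"])
  qed (auto simp: path_alg_add_closed add.assoc add.commute, simp add: path_alg_carrier_iff)
  show "monoid ?P"
    using path_alg_scaled_one_closed[OF fin, of 1] path_iota_mult[OF fin, of _ 1]
    by (intro monoidI) (auto simp: path_iota_1 path_alg_mult_closed path_alg_assoc)
next
  fix f g h :: "'v \<times> 'a list \<Rightarrow> 'k"
  assume car: "f \<in> carrier ?P" "g \<in> carrier ?P" "h \<in> carrier ?P"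
  show "(f \<oplus>\<^bsub>?P\<^esub> g) \<otimes>\<^bsub>?P\<^esub> h = f \<otimes>\<^bsub>?P\<^esub> h \<oplus>\<^bsub>?P\<^esub> g \<otimes>\<^bsub>?P\<^esub> h"
    using car by (auto simp: path_alg_mult path_alg_add_closed distrib_right sum.distrib)
  show "h \<otimes>\<^bsub>?P\<^esub> (f \<oplus>\<^bsub>?P\<^esub> g) = h \<otimes>\<^bsub>?P\<^esub> f \<oplus>\<^bsub>?P\<^esub> h \<otimes>\<^bsub>?P\<^esub> g"
    using car by (auto simp: path_alg_mult path_alg_add_closed distrib_left sum.distrib)
qed

lemma path_alg_uminus:
  fixes f :: "'v \<times> 'a list \<Rightarrow> 'k::field"
  assumes "finite (verts Q)" "f \<in> carrier (path_alg Q)"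
  shows "\<ominus>\<^bsub>path_alg Q\<^esub> f = (\<lambda>p. - f p)"
proof -
  interpret ring "path_alg Q :: ('v \<times> 'a list \<Rightarrow> 'k) ring"
    by (rule path_alg_ring[OF assms(1)])
  show ?thesis
    using assms path_alg_scale_closed[of f Q "-1"] by (intro minus_equality) auto
qed

section \<open>Basis paths and the filtration by path length\<close>

lemma path_basis_closed: "is_path Q p \<Longrightarrow> path_basis p \<in> carrier (path_alg Q)"
  by (auto simp: path_alg_carrier_iff path_basis_def)

lemma path_basis_in_arrow_ideal_pow:
  assumes "is_path Q p" "k \<le> length (snd p)"
  shows "path_basis p \<in> arrow_ideal_pow Q k"
  using path_basis_closed[OF assms(1)] assms(2) by (auto simp: arrow_ideal_pow_def path_basis_def)

lemma arrow_ideal_pow_mult: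
  assumes "f \<in> arrow_ideal_pow Q a" "g \<in> arrow_ideal_pow Q b"
  shows "f \<otimes>\<^bsub>path_alg Q\<^esub> g \<in> arrow_ideal_pow Q (a + b)"
proof -
  have car: "f \<in> carrier (path_alg Q)" "g \<in> carrier (path_alg Q)"
    using assms by (auto simp: arrow_ideal_pow_def)
  have "a + b \<le> length xs" if nz: "(f \<otimes>\<^bsub>path_alg Q\<^esub> g) (v, xs) \<noteq> 0" for v xs
  proof -
    from path_alg_mult_nonzeroE[OF car nz] obtain k where k: "k \<le> length xs"
      "f (v, take k xs) \<noteq> 0" "g (path_end Q (v, take k xs), drop k xs) \<noteq> 0"
      by blast
    then have "a \<le> length (take k xs)" "b \<le> length (drop k xs)"
      using assms by (auto simp: arrow_ideal_pow_def simp del: length_take length_drop)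
    then show ?thesis using k by simp
  qed
  then show ?thesis using car by (auto simp: arrow_ideal_pow_def path_alg_mult_closed)
qed


lemma path_basis_mult:
  assumes "is_path Q (v, xs @ ys)"
  shows "path_basis (v, xs) \<otimes>\<^bsub>path_alg Q\<^esub> path_basis (path_end Q (v, xs), ys)
    = (path_basis (v, xs @ ys) :: 'v \<times> 'a list \<Rightarrow> 'k::field)" (is "?f \<otimes>\<^bsub>_\<^esub> ?g = ?h")
proof
  fix p :: "'v \<times> 'a list"
  obtain w ws where p: "p = (w, ws)" by (cases p)
  have car: "?f \<in> carrier (path_alg Q)" "?g \<in> carrier (path_alg Q)"
    using assms by (auto simp: is_path_append intro!: path_basis_closed)
  have "(?f \<otimes>\<^bsub>path_alg Q\<^esub> ?g) p =
      (\<Sum>k=0..length ws. if k = length xs then ?h p else 0)"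
    unfolding p path_alg_mult[OF car]
  proof (rule sum.cong[OF refl])
    fix k assume "k \<in> {0..length ws}"
    then have "take k ws = xs \<and> drop k ws = ys \<longleftrightarrow> k = length xs \<and> ws = xs @ ys"
      by (metis append_eq_conv_conj append_take_drop_id atLeastAtMost_iff length_take min.absorb2)
    then have "(if k = length xs then ?h (w, ws) else 0)
        = (if w = v \<and> take k ws = xs \<and> drop k ws = ys then 1 else 0)"
      by (simp add: path_basis_def)
    then show "?f (w, take k ws) * ?g (path_end Q (w, take k ws), drop k ws)
        = (if k = length xs then ?h (w, ws) else 0)"
      by (auto simp: path_basis_def)
  qed
  also have "\<dots> = ?h p" by (auto simp: path_basis_def p)
  finally show "(?f \<otimes>\<^bsub>path_alg Q\<^esub> ?g) p = ?h p" .
qed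

lemma arrow_ideal_pow_mono: "a \<le> b \<Longrightarrow> arrow_ideal_pow Q b \<subseteq> arrow_ideal_pow Q a"
  by (fastforce simp: arrow_ideal_pow_def)

lemma arrow_ideal_pow_ideal:
  assumes fin: "finite (verts Q)"
  shows "ideal (arrow_ideal_pow Q k) (path_alg Q :: ('v \<times> 'a list \<Rightarrow> 'k::field) ring)"
proof -
  interpret ring "path_alg Q :: ('v \<times> 'a list \<Rightarrow> 'k) ring" by (rule path_alg_ring[OF fin])
  show ?thesis
  proof (rule idealI)
    show "subgroup (arrow_ideal_pow Q k) (add_monoid (path_alg Q :: ('v \<times> 'a list \<Rightarrow> 'k) ring))"
    proof (rule add.subgroupI)
      show "arrow_ideal_pow Q k \<subseteq> carrier (path_alg Q)" by (auto simp: arrow_ideal_pow_def)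
      have "(\<lambda>_. 0) \<in> arrow_ideal_pow Q k"
        by (simp add: arrow_ideal_pow_def path_alg_carrier_iff)
      then show "arrow_ideal_pow Q k \<noteq> {}" by blast
    next
      fix f :: "'v \<times> 'a list \<Rightarrow> 'k" assume f: "f \<in> arrow_ideal_pow Q k"
      then show "\<ominus>\<^bsub>path_alg Q\<^esub> f \<in> arrow_ideal_pow Q k"
        using a_inv_closed[of f] fin by (auto simp: arrow_ideal_pow_def path_alg_uminus)
    next
      fix f g :: "'v \<times> 'a list \<Rightarrow> 'k" assume "f \<in> arrow_ideal_pow Q k" "g \<in> arrow_ideal_pow Q k"
      then show "f \<oplus>\<^bsub>path_alg Q\<^esub> g \<in> arrow_ideal_pow Q k"
        using path_alg_add_closed[of f Q g] by (simp add: arrow_ideal_pow_def) (metis add_0)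
    qed
  next
    fix f g :: "'v \<times> 'a list \<Rightarrow> 'k"
    assume "f \<in> arrow_ideal_pow Q k" "g \<in> carrier (path_alg Q)"
    then show "g \<otimes>\<^bsub>path_alg Q\<^esub> f \<in> arrow_ideal_pow Q k" "f \<otimes>\<^bsub>path_alg Q\<^esub> g \<in> arrow_ideal_pow Q k"
      using arrow_ideal_pow_mult[of g Q 0 f k] arrow_ideal_pow_mult[of f Q k g 0]
      by (auto simp: arrow_ideal_pow_def)
  qed (rule ring_axioms)
qed

section \<open>Jacobson radicals of bound quiver algebras\<close>

text \<open>If x were outside a maximal left ideal L, then L + Rx would be the whole ring and 1 = l
  + rx with rx nilpotent; this already forces 1 into L.\<close>

lemma (in ring) nil_in_jacobson_rad:
  assumes x: "x \<in> carrier R"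
    and nil: "\<And>r. r \<in> carrier R \<Longrightarrow> \<exists>m::nat. (r \<otimes> x) [^] m = \<zero>"
  shows "x \<in> jacobson_rad R"
proof -
  have "x \<in> L" if L: "maximal_left_ideal R L" for L
  proof (rule ccontr)
    assume "x \<notin> L"
    have LI: "L \<subseteq> carrier R" "\<zero> \<in> L" "\<And>a b. a \<in> L \<Longrightarrow> b \<in> L \<Longrightarrow> a \<oplus> b \<in> L"
      "\<And>a. a \<in> L \<Longrightarrow> \<ominus> a \<in> L" "\<And>r a. r \<in> carrier R \<Longrightarrow> a \<in> L \<Longrightarrow> r \<otimes> a \<in> L"
      "L \<noteq> carrier R"
      using L by (auto simp: maximal_left_ideal_def left_ideal_def)
    define L' where "L' = {l \<oplus> r \<otimes> x | l r. l \<in> L \<and> r \<in> carrier R}"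
    have "left_ideal R L'"
      unfolding left_ideal_def
    proof (intro conjI ballI)
      show "L' \<subseteq> carrier R" using LI(1) x by (auto simp: L'_def)
      have "\<zero> = \<zero> \<oplus> \<zero> \<otimes> x" using x by simp
      then show "\<zero> \<in> L'" unfolding L'_def using LI(2) by blast
    next
      fix a b assume "a \<in> L'" "b \<in> L'"
      then obtain l r l' r' where *: "a = l \<oplus> r \<otimes> x" "b = l' \<oplus> r' \<otimes> x" "l \<in> L" "l' \<in> L"
        "r \<in> carrier R" "r' \<in> carrier R" by (auto simp: L'_def)
      then have "a \<oplus> b = (l \<oplus> l') \<oplus> (r \<oplus> r') \<otimes> x"
        using x LI(1) by (auto simp: subset_iff l_distr a_ac)
      moreover have "r \<oplus> r' \<in> carrier R" using * by simp
      ultimately show "a \<oplus> b \<in> L'" using * LI(3) unfolding L'_def by blast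
    next
      fix a assume "a \<in> L'"
      then obtain l r where *: "a = l \<oplus> r \<otimes> x" "l \<in> L" "r \<in> carrier R" by (auto simp: L'_def)
      then have "\<ominus> a = \<ominus> l \<oplus> (\<ominus> r) \<otimes> x"
        using x LI(1) by (auto simp: subset_iff l_minus minus_add)
      moreover have "\<ominus> r \<in> carrier R" using * by simp
      ultimately show "\<ominus> a \<in> L'" using * LI(4) unfolding L'_def by blast
    next
      fix s a assume s: "s \<in> carrier R" and "a \<in> L'"
      then obtain l r where *: "a = l \<oplus> r \<otimes> x" "l \<in> L" "r \<in> carrier R" by (auto simp: L'_def)
      then have "s \<otimes> a = s \<otimes> l \<oplus> (s \<otimes> r) \<otimes> x"
        using s x LI(1) by (auto simp: subset_iff r_distr m_assoc)
      moreover have "s \<otimes> r \<in> carrier R" using * s by simp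
      ultimately show "s \<otimes> a \<in> L'" using * s LI(5) unfolding L'_def by blast
    qed
    moreover have "L \<subseteq> L'"
    proof
      fix l assume "l \<in> L"
      then have "l = l \<oplus> \<zero> \<otimes> x" using x LI(1) by auto
      then show "l \<in> L'" using \<open>l \<in> L\<close> unfolding L'_def by blast
    qed
    moreover have "x = \<zero> \<oplus> \<one> \<otimes> x" using x by simp
    then have "x \<in> L'" unfolding L'_def using LI(2) by blast
    ultimately have "L' = carrier R"
      using L \<open>x \<notin> L\<close> unfolding maximal_left_ideal_def by metis
    then obtain l r where l: "\<one> = l \<oplus> r \<otimes> x" "l \<in> L" and r: "r \<in> carrier R"
      unfolding L'_def using one_closed by blast
    define n where "n = r \<otimes> x"
    have n: "n \<in> carrier R" using r x by (simp add: n_def)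
    have lc: "l \<in> carrier R" using l LI(1) by auto
    obtain m :: nat where m: "n [^] m = \<zero>" using nil[OF r] by (auto simp: n_def)
    \<comment> \<open>As 1 = l + n, each power is n^k = n^k l + n^(k+1), so membership descends from n^m = 0 to n^0 = 1.\<close>
    have "n [^] (m - k) \<in> L" for k
    proof (induction k)
      case 0
      then show ?case using m LI(2) by simp
    next
      case (Suc k)
      show ?case
      proof (cases "k < m")
        case True
        then obtain j where j: "m - k = Suc j" "m - Suc k = j"
          by (metis Suc_diff_Suc)
        have "n [^] j = n [^] j \<otimes> (l \<oplus> n)" using n by (simp flip: l(1)[folded n_def])
        also have "\<dots> = n [^] j \<otimes> l \<oplus> n [^] Suc j" using n lc by (simp add: r_distr)
        finally show ?thesis using Suc j n l LI(3,5) by (metis nat_pow_closed)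
      qed (use Suc in simp)
    qed
    from this[of m] have "\<one> \<in> L" by simp
    then have "carrier R \<subseteq> L" using LI(5) by fastforce
    then show False using LI(1,6) by auto
  qed
  then show ?thesis using x by (auto simp: jacobson_rad_def)
qed

lemma carrier_Quot: "X \<in> carrier (R Quot J) \<longleftrightarrow> (\<exists>x\<in>carrier R. X = J +>\<^bsub>R\<^esub> x)"
  by (auto simp: FactRing_def A_RCOSETS_def')

text \<open>Shared setting for A and for the Brauer cycle algebra; both are instances. Since
  relations lie in the arrow ideal, the coefficient at a trivial path depends only on the class
  modulo I, and this is what makes the radical computable.\<close>

locale bound_quiver = ideal I "path_alg Q"
  for Q :: "('v, 'a, 'm) quiver_scheme" and I :: "('v \<times> 'a list \<Rightarrow> 'k::field) set" +
  assumes finite_verts: "finite (verts Q)"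
    and relations_in_arrow_ideal: "I \<subseteq> arrow_ideal_pow Q 1"
begin

abbreviation P :: "('v \<times> 'a list \<Rightarrow> 'k) ring" where "P \<equiv> path_alg Q"
abbreviation A :: "('v \<times> 'a list \<Rightarrow> 'k) set ring" where "A \<equiv> bound_alg Q I"
abbreviation \<iota> :: "'k \<Rightarrow> ('v \<times> 'a list \<Rightarrow> 'k) set" where "\<iota> \<equiv> bound_iota Q I"
abbreviation cls :: "('v \<times> 'a list \<Rightarrow> 'k) \<Rightarrow> ('v \<times> 'a list \<Rightarrow> 'k) set" where
  "cls f \<equiv> I +>\<^bsub>path_alg Q\<^esub> f"

sublocale proj: ring_hom_ring P A "\<lambda>f. cls f"
  unfolding bound_alg_def by (rule rcos_ring_hom_ring)

lemma relation_zero_at_vertex: "f \<in> I \<Longrightarrow> f (v, []) = 0"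
  using relations_in_arrow_ideal by (force simp: arrow_ideal_pow_def)

lemma carrier_A: "X \<in> carrier A \<longleftrightarrow> (\<exists>f\<in>carrier P. X = cls f)"
  unfolding bound_alg_def by (rule carrier_Quot)

lemma cls_eq_iff:
  assumes "f \<in> carrier P" "g \<in> carrier P"
  shows "cls f = cls g \<longleftrightarrow> (\<lambda>p. f p - g p) \<in> I"
proof -
  have "cls f = cls g \<longleftrightarrow> f \<ominus>\<^bsub>P\<^esub> g \<in> I"
    using assms quotient_eq_iff_same_a_r_cos ideal_axioms by metis
  then show ?thesis
    using assms finite_verts by (simp add: a_minus_def path_alg_uminus)
qed

lemma zero_fun_closed: "(\<lambda>_. 0) \<in> carrier P"
  by (simp add: path_alg_carrier_iff)

lemma cls_eq_zero_iff: "f \<in> carrier P \<Longrightarrow> cls f = \<zero>\<^bsub>A\<^esub> \<longleftrightarrow> f \<in> I"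
  using cls_eq_iff[of f "\<zero>\<^bsub>P\<^esub>"] proj.hom_zero zero_fun_closed by simp

text \<open>A choice of representatives turns functions on the path algebra into functions on
  cosets. The choice is immaterial for linear functions vanishing on I.\<close>

definition rep :: "('v \<times> 'a list \<Rightarrow> 'k) set \<Rightarrow> 'v \<times> 'a list \<Rightarrow> 'k" where
  "rep X = (SOME f. f \<in> carrier P \<and> X = cls f)"

lemma rep: "X \<in> carrier A \<Longrightarrow> rep X \<in> carrier P \<and> X = cls (rep X)"
  unfolding rep_def carrier_A by (rule someI_ex[of "\<lambda>f. f \<in> carrier P \<and> X = cls f"]) blast

lemma rep_cls:
  assumes f: "f \<in> carrier P"
  shows "(\<lambda>p. rep (cls f) p - f p) \<in> I"
proof -
  have R: "rep (cls f) \<in> carrier P" "cls (rep (cls f)) = cls f"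
    using rep[OF proj.hom_closed[OF f]] by simp_all
  show ?thesis by (rule iffD1[OF cls_eq_iff[OF R(1) f] R(2)])
qed

lemma iota_closed: "path_iota Q c \<in> carrier P"
  by (rule path_alg_scaled_one_closed[OF finite_verts])

lemma iota_mult_cls: "f \<in> carrier P \<Longrightarrow> \<iota> c \<otimes>\<^bsub>A\<^esub> cls f = cls (\<lambda>p. c * f p)"
  using proj.hom_mult[OF iota_closed, of f c] path_iota_mult(1)[OF finite_verts, of f c]
  by (simp add: bound_iota_def)

lemma scale_relation: "f \<in> I \<Longrightarrow> (\<lambda>p. c * f p) \<in> I"
  using I_l_closed[OF _ iota_closed, of f c] path_iota_mult(1)[OF finite_verts, of f c] a_subset
  by auto

text \<open>The coefficient at the trivial path of a vertex is a character of A with values in the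
  field, so its kernel M is a maximal left ideal. A radical element lies in all these kernels, hence
  its representative has no terms of length zero.\<close>

lemma jacobson_rad_subset: "jacobson_rad A \<subseteq> (\<lambda>f. cls f) ` arrow_ideal_pow Q 1"
proof
  fix X assume X: "X \<in> jacobson_rad A"
  then have XA: "X \<in> carrier A" by (simp add: jacobson_rad_def)
  define f where "f = rep X"
  have f: "f \<in> carrier P" "X = cls f" using rep[OF XA] by (auto simp: f_def)
  have "f (v, []) = 0" if v: "v \<in> verts Q" for v
  proof -
    define M where "M = (\<lambda>h. cls h) ` {h \<in> carrier P. h (v, []) = 0}"
    have M_iff: "cls h \<in> M \<longleftrightarrow> h (v, []) = 0" if "h \<in> carrier P" for h
      using that relation_zero_at_vertex[of _ v] by (force simp: M_def cls_eq_iff)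
    have one: "\<one>\<^bsub>P\<^esub> (v, []) = 1" using v by (simp add: path_alg_one)
    have "left_ideal A M"
      unfolding left_ideal_def
    proof (intro conjI ballI)
      show "M \<subseteq> carrier A" by (auto simp: M_def)
      show "\<zero>\<^bsub>A\<^esub> \<in> M" using M_iff[of "\<zero>\<^bsub>P\<^esub>"] proj.hom_zero zero_fun_closed by simp
    next
      fix X Y assume "X \<in> M" "Y \<in> M"
      then obtain h h' where "X = cls h" "Y = cls h'" "h \<in> carrier P" "h' \<in> carrier P"
        "h (v, []) = 0" "h' (v, []) = 0" by (auto simp: M_def)
      then show "X \<oplus>\<^bsub>A\<^esub> Y \<in> M"
        using M_iff[of "h \<oplus>\<^bsub>P\<^esub> h'"] by (simp flip: proj.hom_add del: path_alg_add) simp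
    next
      fix X assume "X \<in> M"
      then obtain h where "X = cls h" "h \<in> carrier P" "h (v, []) = 0" by (auto simp: M_def)
      then show "\<ominus>\<^bsub>A\<^esub> X \<in> M"
        using M_iff[of "\<ominus>\<^bsub>P\<^esub> h"] finite_verts a_inv_closed[of h]
        by (simp add: path_alg_uminus flip: proj.hom_a_inv)
    next
      fix X Y assume "X \<in> carrier A" "Y \<in> M"
      then obtain h h' where "X = cls h" "Y = cls h'" "h \<in> carrier P" "h' \<in> carrier P"
        "h' (v, []) = 0" by (auto simp: M_def carrier_A)
      then show "X \<otimes>\<^bsub>A\<^esub> Y \<in> M"
        using M_iff[of "h \<otimes>\<^bsub>P\<^esub> h'"] by (simp add: path_alg_mult_nil flip: proj.hom_mult)
    qed
    moreover have "M \<noteq> carrier A"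
      using M_iff[of "\<one>\<^bsub>P\<^esub>"] one by auto
    moreover have "L = M" if L: "left_ideal A L" "M \<subseteq> L" "L \<noteq> carrier A" for L
    proof (rule ccontr)
      assume "L \<noteq> M"
      then obtain Y where Y: "Y \<in> L" "Y \<notin> M" using L by auto
      then have "Y \<in> carrier A" using L(1) by (auto simp: left_ideal_def)
      then obtain h where h: "h \<in> carrier P" "Y = cls h" by (auto simp: carrier_A)
      define c where "c = h (v, [])"
      have c: "c \<noteq> 0" using Y(2) h M_iff by (auto simp: c_def)
      \<comment> \<open>\<open>e\<close> is \<open>h\<close> scaled to coefficient 1 at
        \<open>v\<close>, and \<open>d\<close> is 1 - \<open>e\<close>, with coefficient 0 there. So
        1 = \<open>d\<close> + \<open>e\<close> modulo I, with the class of \<open>d\<close> in M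
        and the class of \<open>e\<close> in L.\<close>
      define e where "e = (\<lambda>p. inverse c * h p)"
      define d where "d = (\<lambda>p. \<one>\<^bsub>P\<^esub> p + (- 1) * e p)"
      have e: "e \<in> carrier P" unfolding e_def by (rule path_alg_scale_closed[OF h(1)])
      have d: "d \<in> carrier P"
        unfolding d_def by (intro path_alg_add_closed path_alg_scale_closed one_closed e)
      have "d (v, []) = 0" using c one by (simp add: d_def e_def flip: c_def)
      then have dL: "cls d \<in> L" using M_iff[OF d] L(2) by auto
      have eL: "cls e \<in> L"
        using L(1) Y(1) h iota_mult_cls[OF h(1), of "inverse c"] proj.hom_closed[OF iota_closed]
        unfolding bound_iota_def left_ideal_def e_def by metis
      have "\<one>\<^bsub>P\<^esub> = d \<oplus>\<^bsub>P\<^esub> e" by (auto simp: d_def)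
      then have "cls \<one>\<^bsub>P\<^esub> = cls (d \<oplus>\<^bsub>P\<^esub> e)" by (rule arg_cong)
      then have "\<one>\<^bsub>A\<^esub> = cls d \<oplus>\<^bsub>A\<^esub> cls e"
        unfolding proj.hom_one proj.hom_add[OF d e] .
      then have "\<one>\<^bsub>A\<^esub> \<in> L" using dL eL L(1) by (auto simp: left_ideal_def)
      then have "Z \<otimes>\<^bsub>A\<^esub> \<one>\<^bsub>A\<^esub> \<in> L" if "Z \<in> carrier A" for Z
        using L(1) that unfolding left_ideal_def by blast
      then have "carrier A \<subseteq> L" by auto
      then show False using L(1,3) by (auto simp: left_ideal_def)
    qed
    ultimately have "maximal_left_ideal A M" by (auto simp: maximal_left_ideal_def)
    then have "X \<in> M" using X by (auto simp: jacobson_rad_def)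
    then show ?thesis using M_iff f by auto
  qed
  moreover have "f (v, []) = 0" if "v \<notin> verts Q" for v
    using f(1) that by (force simp: path_alg_carrier_iff)
  ultimately have "f (v, []) = 0" for v by blast
  then have "1 \<le> length xs" if "f (v, xs) \<noteq> 0" for v xs
    using that by (cases xs) auto
  then have "f \<in> arrow_ideal_pow Q 1"
    using f(1) by (auto simp: arrow_ideal_pow_def)
  then show "X \<in> (\<lambda>f. cls f) ` arrow_ideal_pow Q 1" using f(2) by auto
qed

lemma arrow_ideal_nat_pow:
  "f \<in> arrow_ideal_pow Q 1 \<Longrightarrow> f [^]\<^bsub>P\<^esub> (k::nat) \<in> arrow_ideal_pow Q k"
proof (induction k)
  case 0
  then show ?case using one_closed by (auto simp: arrow_ideal_pow_def)
next
  case (Suc k)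
  then show ?case using arrow_ideal_pow_mult[of "f [^]\<^bsub>P\<^esub> k" Q k f 1] by simp
qed

lemma arrow_ideal_nilpotent:
  assumes "f \<in> arrow_ideal_pow Q 1" "arrow_ideal_pow Q m \<subseteq> I"
  shows "cls f [^]\<^bsub>A\<^esub> m = \<zero>\<^bsub>A\<^esub>"
proof -
  have f: "f \<in> carrier P" using assms by (simp add: arrow_ideal_pow_def)
  have "f [^]\<^bsub>P\<^esub> m \<in> I" using arrow_ideal_nat_pow[OF assms(1)] assms(2) by auto
  then show ?thesis using cls_eq_zero_iff[of "f [^]\<^bsub>P\<^esub> m"] f by (simp add: proj.hom_nat_pow)
qed

text \<open>Left multiples of an element of the arrow ideal stay in the arrow ideal, and its
  elements are nilpotent modulo I because a power of it lies in I.\<close>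

lemma arrow_ideal_subset_jacobson_rad:
  assumes f: "f \<in> arrow_ideal_pow Q 1" and m: "arrow_ideal_pow Q m \<subseteq> I"
  shows "cls f \<in> jacobson_rad A"
proof (rule proj.S.nil_in_jacobson_rad)
  have fP: "f \<in> carrier P" using f by (simp add: arrow_ideal_pow_def)
  then show "cls f \<in> carrier A" by simp
  fix r assume "r \<in> carrier A"
  then obtain h where h: "h \<in> carrier P" "r = cls h" by (auto simp: carrier_A)
  then have "h \<in> arrow_ideal_pow Q 0" by (simp add: arrow_ideal_pow_def)
  from arrow_ideal_pow_mult[OF this f] have "h \<otimes>\<^bsub>P\<^esub> f \<in> arrow_ideal_pow Q 1" by simp
  from arrow_ideal_nilpotent[OF this m] show "\<exists>m::nat. (r \<otimes>\<^bsub>A\<^esub> cls f) [^]\<^bsub>A\<^esub> m = \<zero>\<^bsub>A\<^esub>"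
    using h fP by auto
qed

text \<open>Taking the coefficient at a trivial path is multiplicative and kills I, so a nilpotent
  class yields a nilpotent scalar, which is zero.\<close>

lemma nilpotent_in_arrow_ideal:
  assumes f: "f \<in> carrier P" and nil: "cls f [^]\<^bsub>A\<^esub> (m::nat) = \<zero>\<^bsub>A\<^esub>"
  shows "f \<in> arrow_ideal_pow Q 1"
proof -
  have pow: "(f [^]\<^bsub>P\<^esub> k) (v, []) = f (v, []) ^ k" if "v \<in> verts Q" for v and k :: nat
    by (induction k) (use f that in \<open>simp_all add: path_alg_one path_alg_mult_nil\<close>)
  have "f [^]\<^bsub>P\<^esub> m \<in> I"
    using nil f cls_eq_zero_iff[of "f [^]\<^bsub>P\<^esub> m"] by (simp add: proj.hom_nat_pow)
  then have "f (v, []) = 0" if "v \<in> verts Q" for v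
    using relation_zero_at_vertex pow[OF that] by (metis power_not_zero)
  moreover have "f (v, []) = 0" if "v \<notin> verts Q" for v
    using f that by (force simp: path_alg_carrier_iff)
  ultimately have "f (v, []) = 0" for v by blast
  then have "1 \<le> length xs" if "f (v, xs) \<noteq> 0" for v xs
    using that by (cases xs) auto
  then show ?thesis using f by (auto simp: arrow_ideal_pow_def)
qed

section \<open>Separation of points by the dual space\<close>

lemma zero_in_kdual: "(\<lambda>_. 0) \<in> kdual A \<iota>"
  by (simp add: kdual_def)

text \<open>A nonzero class has its representative outside the subspace I. A basis of I extended by
  this representative carries a linear functional that is 1 on the representative and 0 on I, and
  such a functional descends to A.\<close>

lemma kdual_separates:
  assumes X: "X \<in> carrier A" and zero: "\<And>g. g \<in> kdual A \<iota> \<Longrightarrow> g X = 0"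
  shows "X = \<zero>\<^bsub>A\<^esub>"
proof (rule ccontr)
  assume nz: "X \<noteq> \<zero>\<^bsub>A\<^esub>"
  \<comment> \<open>The linear algebra takes place in the space of all functions on pairs of a
    vertex and a list, because the vector space locale works on a whole type; I is a subspace of
    it.\<close>
  let ?sc = "\<lambda>(c::'k) (f :: 'v \<times> 'a list \<Rightarrow> 'k) p. c * f p"
  have vs: "vector_space ?sc"
    by unfold_locales (auto simp: fun_eq_iff algebra_simps)
  interpret vector_space_pair ?sc "(*) :: 'k \<Rightarrow> 'k \<Rightarrow> 'k"
    using vs by (intro vector_space_pair.intro) (unfold_locales, auto simp: algebra_simps)
  have sub: "vs1.subspace I"
    unfolding vs1.subspace_def
    using scale_relation additive_subgroup.zero_closed[OF is_additive_subgroup]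
      additive_subgroup.a_closed[OF is_additive_subgroup]
    by (auto simp: zero_fun_def plus_fun_def)
  obtain B where B: "B \<subseteq> I" "vs1.independent B" "I \<subseteq> vs1.span B"
    using vs1.maximal_independent_subset by blast
  have span: "vs1.span B = I" using B vs1.span_minimal[OF B(1) sub] by blast
  have w: "rep X \<notin> vs1.span B"
    using rep[OF X] nz cls_eq_zero_iff[of "rep X"] by (auto simp: span)
  then have "vs1.independent (insert (rep X) B)"
    using B(2) by (simp add: vs1.independent_insert)
  from linear_independent_extend[OF this, of "\<lambda>b. if b = rep X then 1 else 0"]
  obtain l where l: "Vector_Spaces.linear ?sc (*) l" "l (rep X) = 1" "\<And>b. b \<in> B \<Longrightarrow> l b = 0"
    using w vs1.span_base by (metis insert_iff)
  interpret l: Vector_Spaces.linear ?sc "(*)" l by (rule l(1))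
  have l0: "l f = 0" if "f \<in> I" for f
    using that l.eq_0_on_span[of B f] l(3) by (simp add: span)
  have lrep: "l (rep (cls f)) = l f" if f: "f \<in> carrier P" for f
    using l0[OF rep_cls[OF f]] l.diff[of "rep (cls f)" f] by (simp add: fun_diff_def)
  \<comment> \<open>The value 0 outside the carrier is the normalisation that \<open>kdual\<close>
    demands.\<close>
  define g where "g Y = (if Y \<in> carrier A then l (rep Y) else 0)" for Y
  have gcls: "g (cls f) = l f" if "f \<in> carrier P" for f
    using that by (simp add: g_def lrep)
  have "g \<in> kdual A \<iota>"
    unfolding kdual_def
  proof (intro CollectI conjI ballI allI impI)
    fix Y Z assume "Y \<in> carrier A" "Z \<in> carrier A"
    then obtain f h where "Y = cls f" "Z = cls h" "f \<in> carrier P" "h \<in> carrier P"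
      by (auto simp: carrier_A)
    then show "g (Y \<oplus>\<^bsub>A\<^esub> Z) = g Y + g Z"
      using gcls[of "f \<oplus>\<^bsub>P\<^esub> h"] gcls l.add[of f h] path_alg_add_closed[of f Q h]
      by (simp add: plus_fun_def flip: proj.hom_add)
  next
    fix c Y assume "Y \<in> carrier A"
    then obtain f where "Y = cls f" "f \<in> carrier P" by (auto simp: carrier_A)
    then show "g (\<iota> c \<otimes>\<^bsub>A\<^esub> Y) = c * g Y"
      using gcls l.scale[of c f] path_alg_scale_closed[of f Q c] by (simp add: iota_mult_cls)
  qed (simp add: g_def)
  then have "g X = 0" by (rule zero)
  then show False using l(2) X by (simp add: g_def)
qed

section \<open>Deciding membership in I path by path\<close>

lemma combination_in_ideal:
  assumes f: "f \<in> carrier P" and basis: "\<And>p. f p \<noteq> 0 \<Longrightarrow> path_basis p \<in> I"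
  shows "f \<in> I"
proof -
  have "(\<lambda>p. if p \<in> S then f p else 0) \<in> I" if "finite S" "S \<subseteq> {p. f p \<noteq> 0}" for S
    using that
  proof (induction S rule: finite_induct)
    case empty
    then show ?case using additive_subgroup.zero_closed[OF is_additive_subgroup] by simp
  next
    case (insert q S)
    have "(\<lambda>p. f q * path_basis q p) \<in> I"
      using insert.prems by (intro scale_relation basis) auto
    then have "(\<lambda>p. if p \<in> S then f p else 0) \<oplus>\<^bsub>P\<^esub> (\<lambda>p. f q * path_basis q p) \<in> I"
      using insert by (intro additive_subgroup.a_closed[OF is_additive_subgroup]) auto
    also have "(\<lambda>p. if p \<in> S then f p else 0) \<oplus>\<^bsub>P\<^esub> (\<lambda>p. f q * path_basis q p)
        = (\<lambda>p. if p \<in> insert q S then f p else 0)"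
      using insert.hyps by (auto simp: path_basis_def)
    finally show ?case .
  qed
  from this[of "{p. f p \<noteq> 0}"] have "(\<lambda>p. if p \<in> {p. f p \<noteq> 0} then f p else 0) \<in> I"
    using f by (auto simp: path_alg_carrier_iff)
  also have "(\<lambda>p. if p \<in> {p. f p \<noteq> 0} then f p else 0) = f" by auto
  finally show ?thesis .
qed

lemma subpath_in_ideal:
  assumes path: "is_path Q (v, xs @ ys @ zs)" and ys: "path_basis (path_end Q (v, xs), ys) \<in> I"
  shows "path_basis (v, xs @ ys @ zs) \<in> I"
proof -
  let ?u = "path_end Q (v, xs)"
  have *: "is_path Q (v, xs)" "is_path Q (?u, ys)" "is_path Q (path_end Q (?u, ys), zs)"
    "is_path Q (?u, ys @ zs)"
    using path by (auto simp: is_path_append path_end_append)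
  have "path_basis (?u, ys) \<otimes>\<^bsub>P\<^esub> path_basis (path_end Q (?u, ys), zs) \<in> I"
    using * by (intro I_r_closed ys path_basis_closed)
  then have "path_basis (?u, ys @ zs) \<in> I" by (simp only: path_basis_mult[OF *(4)])
  then have "path_basis (v, xs) \<otimes>\<^bsub>P\<^esub> path_basis (?u, ys @ zs) \<in> I"
    using * by (intro I_l_closed path_basis_closed)
  then show ?thesis by (simp only: path_basis_mult[OF path])
qed

lemma diff_in_ideal:
  assumes "(\<lambda>p. f p - g p) \<in> I" "g \<in> I" "f \<in> carrier P"
  shows "f \<in> I"
proof -
  have "(\<lambda>p. f p - g p) \<oplus>\<^bsub>P\<^esub> g \<in> I"
    using assms by (intro additive_subgroup.a_closed[OF is_additive_subgroup])
  then show ?thesis by simp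
qed

lemma minus_P:
  assumes "f \<in> carrier P" "g \<in> carrier P"
  shows "f \<ominus>\<^bsub>P\<^esub> g = (\<lambda>p. f p - g p)"
  using assms finite_verts by (simp add: a_minus_def path_alg_uminus)

text \<open>Multiplying a binomial relation by a prefix makes the two extended paths congruent
  modulo I, so membership passes from one to the other. The vertex \<open>u\<close> is kept apart
  from \<open>path_end\<close> so that a relation with a literal start vertex can be inserted
  directly.\<close>

lemma exchange_left:
  assumes rel: "(\<lambda>p. path_basis (u, ys) p - path_basis (u, ys') p) \<in> I"
    and u: "u = path_end Q (v, xs)"
    and path: "is_path Q (v, xs @ ys)" "is_path Q (v, xs @ ys')"
    and "path_basis (v, xs @ ys') \<in> I"
  shows "path_basis (v, xs @ ys) \<in> I"
proof -
  let ?u = "path_end Q (v, xs)"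
  have *: "path_basis (v, xs) \<in> carrier P" "path_basis (?u, ys) \<in> carrier P"
    "path_basis (?u, ys') \<in> carrier P"
    using path by (auto simp: is_path_append intro!: path_basis_closed)
  have "path_basis (v, xs) \<otimes>\<^bsub>P\<^esub> (path_basis (?u, ys) \<ominus>\<^bsub>P\<^esub> path_basis (?u, ys')) \<in> I"
    unfolding minus_P[OF *(2,3)] by (intro I_l_closed rel[unfolded u] *)
  also have "path_basis (v, xs) \<otimes>\<^bsub>P\<^esub> (path_basis (?u, ys) \<ominus>\<^bsub>P\<^esub> path_basis (?u, ys'))
      = path_basis (v, xs @ ys) \<ominus>\<^bsub>P\<^esub> path_basis (v, xs @ ys')"
    unfolding path_basis_mult[OF path(1), symmetric] path_basis_mult[OF path(2), symmetric]
    unfolding a_minus_def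
    by (simp only: r_distr r_minus * a_inv_closed m_closed)
  also have "\<dots> = (\<lambda>p. path_basis (v, xs @ ys) p - path_basis (v, xs @ ys') p)"
    by (intro minus_P path_basis_closed path)
  finally show ?thesis
    by (rule diff_in_ideal) (intro assms(5) path_basis_closed path)+
qed

lemma exchange_right:
  assumes rel: "(\<lambda>p. path_basis (v, ys) p - path_basis (v, ys') p) \<in> I"
    and path: "is_path Q (v, ys @ zs)" "is_path Q (v, ys' @ zs)"
    and ends: "path_end Q (v, ys) = path_end Q (v, ys')"
    and "path_basis (v, ys' @ zs) \<in> I"
  shows "path_basis (v, ys @ zs) \<in> I"
proof -
  let ?u = "path_end Q (v, ys)"
  have *: "path_basis (?u, zs) \<in> carrier P" "path_basis (v, ys) \<in> carrier P"
    "path_basis (v, ys') \<in> carrier P"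
    using path by (auto simp: is_path_append intro!: path_basis_closed)
  have "(path_basis (v, ys) \<ominus>\<^bsub>P\<^esub> path_basis (v, ys')) \<otimes>\<^bsub>P\<^esub> path_basis (?u, zs) \<in> I"
    unfolding minus_P[OF *(2,3)] by (intro I_r_closed rel *)
  also have "(path_basis (v, ys) \<ominus>\<^bsub>P\<^esub> path_basis (v, ys')) \<otimes>\<^bsub>P\<^esub> path_basis (?u, zs)
      = path_basis (v, ys @ zs) \<ominus>\<^bsub>P\<^esub> path_basis (v, ys' @ zs)"
    unfolding path_basis_mult[OF path(1), symmetric] path_basis_mult[OF path(2), symmetric]
    unfolding ends[symmetric] a_minus_def
    by (simp only: l_distr l_minus * a_inv_closed m_closed)
  also have "\<dots> = (\<lambda>p. path_basis (v, ys @ zs) p - path_basis (v, ys' @ zs) p)"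
    by (intro minus_P path_basis_closed path)
  finally show ?thesis
    by (rule diff_in_ideal) (intro assms(5) path_basis_closed path)+
qed

end

section \<open>Brauer cycle algebras have vanishing radical cube\<close>

lemma brauer_quiver_simps [simp]:
  "verts (brauer_quiver m) = {0..<m}"
  "(b, i) \<in> arrs (brauer_quiver m) \<longleftrightarrow> i < m"
  "src (brauer_quiver m) (True, i) = i" "src (brauer_quiver m) (False, i) = Suc i mod m"
  "tgt (brauer_quiver m) (True, i) = Suc i mod m" "tgt (brauer_quiver m) (False, i) = i"
  by (auto simp: brauer_quiver_def)

lemma Suc_mod_inj: "i < m \<Longrightarrow> j < m \<Longrightarrow> Suc i mod m = Suc j mod m \<Longrightarrow> i = j"
  by (auto simp: mod_Suc split: if_splits)

lemma brauer_rels_closed: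
  assumes "m \<ge> 1"
  shows "brauer_rels m \<subseteq> arrow_ideal_pow (brauer_quiver m) 2"
proof
  fix f :: "nat \<times> (bool \<times> nat) list \<Rightarrow> 'k::field"
  assume "f \<in> brauer_rels m"
  \<comment> \<open>The difference is spelled as a sum with scalar -1, to fit the closure lemmas for
    sums and multiples.\<close>
  then obtain i j where i: "i < m" and j: "j = Suc i mod m" and
    f: "f = path_basis (i, [(True, i), (True, j)]) \<or>
        f = path_basis (Suc j mod m, [(False, j), (False, i)]) \<or>
        f = (\<lambda>p. path_basis (j, [(False, i), (True, i)]) p
                + (- 1) * path_basis (j, [(True, j), (False, j)]) p)"
    by (auto simp: brauer_rels_def Let_def)
  have "j < m" "Suc j mod m < m" using assms by (simp_all add: j)
  then have "path_basis (i, [(True, i), (True, j)]) \<in> carrier (path_alg (brauer_quiver m))"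
    "path_basis (Suc j mod m, [(False, j), (False, i)]) \<in> carrier (path_alg (brauer_quiver m))"
    "path_basis (j, [(False, i), (True, i)]) \<in> carrier (path_alg (brauer_quiver m))"
    "path_basis (j, [(True, j), (False, j)]) \<in> carrier (path_alg (brauer_quiver m))"
    using i by (auto intro!: path_basis_closed simp: j)
  note c = this
  have "f \<in> carrier (path_alg (brauer_quiver m))"
    using f by (elim disjE)
      (simp_all only: c path_alg_add_closed[OF c(3) path_alg_scale_closed[OF c(4)]])
  moreover have "2 \<le> length xs" if "f (v, xs) \<noteq> 0" for v xs
    using f that by (auto simp: path_basis_def split: if_splits)
  ultimately show "f \<in> arrow_ideal_pow (brauer_quiver m) 2"
    by (simp add: arrow_ideal_pow_def)
qed

lemma brauer_ideal_properties:
  assumes m: "m \<ge> 1"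
  shows "ideal (brauer_ideal m) (path_alg (brauer_quiver m))"
    and "brauer_ideal m \<subseteq> arrow_ideal_pow (brauer_quiver m) 2"
    and "brauer_rels m \<subseteq> brauer_ideal m"
proof -
  interpret ring "path_alg (brauer_quiver m)" by (rule path_alg_ring) simp
  have "brauer_rels m \<subseteq> carrier (path_alg (brauer_quiver m))"
    using brauer_rels_closed[OF m] by (auto simp: arrow_ideal_pow_def)
  then show "ideal (brauer_ideal m) (path_alg (brauer_quiver m))"
    "brauer_rels m \<subseteq> brauer_ideal m"
    unfolding brauer_ideal_def by (rule genideal_ideal, rule genideal_self)
  show "brauer_ideal m \<subseteq> arrow_ideal_pow (brauer_quiver m) 2"
    unfolding brauer_ideal_def
    by (intro genideal_minimal arrow_ideal_pow_ideal brauer_rels_closed m) simp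
qed

lemma bound_quiver_brauer: "m \<ge> 1 \<Longrightarrow> bound_quiver (brauer_quiver m) (brauer_ideal m)"
  using brauer_ideal_properties[of m] arrow_ideal_pow_mono[of 1 2 "brauer_quiver m"]
  by (intro bound_quiver.intro bound_quiver_axioms.intro) auto

lemma brauer_relations:
  assumes m: "m \<ge> 1" and "i < m"
  shows "path_basis (i, [(True, i), (True, Suc i mod m)]) \<in> brauer_ideal m"
    and "path_basis (Suc (Suc i mod m) mod m, [(False, Suc i mod m), (False, i)]) \<in> brauer_ideal m"
    and "(\<lambda>p. path_basis (Suc i mod m, [(False, i), (True, i)]) p
      - path_basis (Suc i mod m, [(True, Suc i mod m), (False, Suc i mod m)]) p) \<in> brauer_ideal m"
  by (rule subsetD[OF brauer_ideal_properties(3)[OF m]], unfold brauer_rels_def Let_def,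
      rule UN_I[of i], use \<open>i < m\<close> in simp, simp)+

text \<open>Two consecutive arrows in the same direction belong to neighbouring edges: the path
  condition alone makes one index the successor of the other.\<close>

lemma brauer_monomial_relations:
  assumes m: "m \<ge> 1" and path: "is_path (brauer_quiver m) (v, [(b, i), (b, j)])"
  shows "path_basis (v, [(b, i), (b, j)]) \<in> brauer_ideal m"
proof (cases b)
  case True
  then have "i < m" "v = i" "j = Suc i mod m" using path by auto
  then show ?thesis using brauer_relations(1)[OF m] True by auto
next
  case False
  then have "j < m" "v = Suc i mod m" "i = Suc j mod m" using path by auto
  then show ?thesis using brauer_relations(2)[OF m] False by auto
qed

text \<open>Only the first three arrows matter. If two neighbours among them point the same way, a
  monomial relation applies. An alternating word becomes such a word after one use of commutativity:
  alpha_i beta_i alpha_i turns into alpha_i alpha_(i+1) beta_(i+1), and beta_i alpha_i beta_i into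
  alpha_(i+1) beta_(i+1) beta_i.\<close>

lemma brauer_long_paths:
  assumes m: "m \<ge> 1" and path: "is_path (brauer_quiver m) (v, xs)" and len: "length xs \<ge> 3"
  shows "path_basis (v, xs) \<in> brauer_ideal m"
proof -
  interpret bound_quiver "brauer_quiver m" "brauer_ideal m"
    by (rule bound_quiver_brauer[OF m])
  from len obtain a b c ys where xs: "xs = a # b # c # ys"
    by (auto simp: numeral_3_eq_3 Suc_le_length_iff)
  obtain p i q j r k where abc: "a = (p, i)" "b = (q, j)" "c = (r, k)"
    by (cases a, cases b, cases c) auto
  have v: "v < m" using path xs by auto
  have "path_basis (v, [a, b, c]) \<in> brauer_ideal m"
  proof -
    have path3: "is_path (brauer_quiver m) (v, [a, b, c])"
      using path is_path_append[of "brauer_quiver m" v "[a, b, c]" ys] by (simp add: xs)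
    have path_ab: "is_path (brauer_quiver m) (v, [a, b])"
      and path_bc: "is_path (brauer_quiver m) (tgt (brauer_quiver m) a, [b, c])"
      using path3 by auto
    consider "p = q" | "q = r" | "p = (\<not> q)" "q = (\<not> r)" by blast
    then show ?thesis
    proof cases
      case 1
      then have "path_basis (v, [a, b]) \<in> brauer_ideal m"
        using path_ab brauer_monomial_relations[OF m, of v q i j] unfolding abc by simp
      then show ?thesis using subpath_in_ideal[of v "[]" "[a, b]" "[c]"] path3 by simp
    next
      case 2
      then have "path_basis (tgt (brauer_quiver m) a, [b, c]) \<in> brauer_ideal m"
        using path_bc brauer_monomial_relations[OF m, of "tgt (brauer_quiver m) a" r j k]
        unfolding abc by simp
      then show ?thesis using subpath_in_ideal[of v "[a]" "[b, c]" "[]"] path3 by simp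
    next
      case 3
      show ?thesis
      proof (cases p)
        case True
        then have pqr: "p = True" "q = False" "r = True" using 3 by auto
        with path3 abc have i: "i < m" "j < m" "v = i" "Suc i mod m = Suc j mod m" "k = j" by auto
        \<comment> \<open>Successor mod m is injective, so an alternating path goes back and forth
          along a single edge.\<close>
        then have ij: "j = i" "k = i" using Suc_mod_inj by auto
        let ?j = "Suc i mod m"
        have p': "is_path (brauer_quiver m) (i, [(True, i), (True, ?j), (False, ?j)])"
          using i by auto
        have "path_basis (i, [(True, i), (True, ?j), (False, ?j)]) \<in> brauer_ideal m"
          using subpath_in_ideal[of i "[]" "[(True, i), (True, ?j)]" "[(False, ?j)]"] p'
            brauer_relations(1)[OF m i(1)] by simp
        then show ?thesis
          using exchange_left[OF brauer_relations(3)[OF m i(1)], of i "[(True, i)]"] path3 p'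
          by (simp add: abc pqr ij i(3))
      next
        case False
        then have pqr: "p = False" "q = True" "r = False" using 3 by auto
        let ?j = "Suc i mod m"
        from pqr path3 abc have i: "i < m" "k < m" "v = ?j" "j = i" "Suc i mod m = Suc k mod m" by auto
        then have ij: "j = i" "k = i" using Suc_mod_inj by auto
        have p': "is_path (brauer_quiver m) (?j, [(True, ?j), (False, ?j), (False, i)])"
          using i by auto
        have "path_basis (?j, [(True, ?j), (False, ?j), (False, i)]) \<in> brauer_ideal m"
          using subpath_in_ideal[of ?j "[(True, ?j)]" "[(False, ?j), (False, i)]" "[]"] p'
            brauer_relations(2)[OF m i(1)] by simp
        then show ?thesis
          using exchange_right[OF brauer_relations(3)[OF m i(1)], of "[(False, i)]"] path3 p'
          by (simp add: abc pqr ij i(3))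
      qed
    qed
  qed
  then show ?thesis using subpath_in_ideal[of v "[]" "[a, b, c]" ys] path by (simp add: xs)
qed

lemma brauer_rad_cube:
  assumes m: "m \<ge> 1"
  shows "arrow_ideal_pow (brauer_quiver m) 3 \<subseteq> brauer_ideal m"
proof
  interpret bound_quiver "brauer_quiver m" "brauer_ideal m"
    by (rule bound_quiver_brauer[OF m])
  fix f :: "nat \<times> (bool \<times> nat) list \<Rightarrow> 'k::field"
  assume f: "f \<in> arrow_ideal_pow (brauer_quiver m) 3"
  show "f \<in> brauer_ideal m"
  proof (rule bound_quiver.combination_in_ideal[OF bound_quiver_brauer[OF m]])
    show "f \<in> carrier (path_alg (brauer_quiver m))" using f by (simp add: arrow_ideal_pow_def)
    fix p assume "f p \<noteq> 0"
    then show "path_basis p \<in> brauer_ideal m"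
      using f brauer_long_paths[OF m, of "fst p" "snd p"]
      by (cases p) (auto simp: arrow_ideal_pow_def path_alg_carrier_iff)
  qed
qed

section \<open>The trivial extension, and necessity of the radical condition\<close>

lemma triv_ext_simps [simp]:
  "carrier (triv_ext R \<iota>) = carrier R \<times> kdual R \<iota>"
  "(a, f) \<oplus>\<^bsub>triv_ext R \<iota>\<^esub> (b, g) = (a \<oplus>\<^bsub>R\<^esub> b, \<lambda>x. f x + g x)"
  "\<one>\<^bsub>triv_ext R \<iota>\<^esub> = (\<one>\<^bsub>R\<^esub>, \<lambda>_. 0)"
  "\<zero>\<^bsub>triv_ext R \<iota>\<^esub> = (\<zero>\<^bsub>R\<^esub>, \<lambda>_. 0)"
  by (simp_all add: triv_ext_def)

lemma triv_ext_mult: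
  "(a, f) \<otimes>\<^bsub>triv_ext R \<iota>\<^esub> (b, g) = (a \<otimes>\<^bsub>R\<^esub> b,
     \<lambda>x. if x \<in> carrier R then g (x \<otimes>\<^bsub>R\<^esub> a) + f (b \<otimes>\<^bsub>R\<^esub> x) else 0)"
  by (simp add: triv_ext_def)

lemma triv_ext_mult_base [simp]:
  "(a, \<lambda>_. 0) \<otimes>\<^bsub>triv_ext R \<iota>\<^esub> (b, \<lambda>_. 0) = (a \<otimes>\<^bsub>R\<^esub> b, \<lambda>_. 0)"
  by (simp add: triv_ext_mult fun_eq_iff)

lemma (in ring) kdual_zero: "g \<in> kdual R \<iota> \<Longrightarrow> g \<zero> = 0"
  unfolding kdual_def using zero_closed r_zero[OF zero_closed] by force

context bound_quiver
begin

abbreviation T where "T \<equiv> triv_ext A \<iota>"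

theorem rad_square_zero_if_brauer:
  assumes brauer: "is_brauer_cycle_alg T (triv_ext_iota \<iota>)"
    and adm: "arrow_ideal_pow Q k \<subseteq> I"
    and X: "X \<in> jacobson_rad A" and Y: "Y \<in> jacobson_rad A"
  shows "X \<otimes>\<^bsub>A\<^esub> Y = \<zero>\<^bsub>A\<^esub>"
proof -
  obtain m \<phi> where m: "m \<ge> 1"
    and \<phi>: "\<phi> \<in> ring_iso T (brauer_cycle_alg m :: (nat \<times> (bool \<times> nat) list \<Rightarrow> 'k) set ring)"
    using brauer by (auto simp: is_brauer_cycle_alg_def alg_iso_def)
  interpret B: bound_quiver "brauer_quiver m" "brauer_ideal m :: (nat \<times> (bool \<times> nat) list \<Rightarrow> 'k) set"
    by (rule bound_quiver_brauer[OF m])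
  have \<phi>_hom: "\<phi> \<in> ring_hom T B.A" and inj: "inj_on \<phi> (carrier T)"
    using \<phi> by (auto simp: ring_iso_def bij_betw_def brauer_cycle_alg_def)
  have zero_T: "\<zero>\<^bsub>T\<^esub> \<in> carrier T" by (simp add: zero_in_kdual)
  have \<phi>_zero: "\<phi> \<zero>\<^bsub>T\<^esub> = \<zero>\<^bsub>B.A\<^esub>"
  proof -
    have "\<phi> \<zero>\<^bsub>T\<^esub> \<oplus>\<^bsub>B.A\<^esub> \<phi> \<zero>\<^bsub>T\<^esub> = \<phi> \<zero>\<^bsub>T\<^esub>"
      using ring_hom_add[OF \<phi>_hom zero_T zero_T] by simp
    then show ?thesis
      using ring_hom_closed[OF \<phi>_hom zero_T] B.proj.S.add.l_cancel_one by metis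
  qed
  have rad: "\<exists>f\<in>arrow_ideal_pow (brauer_quiver m) 1. \<phi> (Z, \<lambda>_. 0) = B.cls f"
    if Z: "Z \<in> jacobson_rad A" for Z
  proof -
    obtain h where h: "h \<in> arrow_ideal_pow Q 1" "Z = cls h" using jacobson_rad_subset Z by auto
    have ZA: "Z \<in> carrier A" using Z by (simp add: jacobson_rad_def)
    \<comment> \<open>For the same reason powers are formed in A and in the Brauer cycle algebra,
      linked by multiplicativity on pairs with zero dual part.\<close>
    have pow: "\<phi> (Z [^]\<^bsub>A\<^esub> l, \<lambda>_. 0) = \<phi> (Z, \<lambda>_. 0) [^]\<^bsub>B.A\<^esub> l" for l :: nat
    proof (induction l)
      case 0
      then show ?case using ring_hom_one[OF \<phi>_hom] by simp
    next
      case (Suc l)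
      have "\<phi> (Z [^]\<^bsub>A\<^esub> Suc l, \<lambda>_. 0) = \<phi> ((Z [^]\<^bsub>A\<^esub> l, \<lambda>_. 0) \<otimes>\<^bsub>T\<^esub> (Z, \<lambda>_. 0))"
        by simp
      also have "\<dots> = \<phi> (Z [^]\<^bsub>A\<^esub> l, \<lambda>_. 0) \<otimes>\<^bsub>B.A\<^esub> \<phi> (Z, \<lambda>_. 0)"
        by (rule ring_hom_mult[OF \<phi>_hom]) (use ZA zero_in_kdual in simp_all)
      finally show ?case using Suc by simp
    qed
    have car: "\<phi> (Z, \<lambda>_. 0) \<in> carrier B.A"
      using ring_hom_closed[OF \<phi>_hom] ZA zero_in_kdual by simp
    then obtain f where f: "f \<in> carrier B.P" "\<phi> (Z, \<lambda>_. 0) = B.cls f"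
      by (auto simp: B.carrier_A)
    have "B.cls f [^]\<^bsub>B.A\<^esub> k = \<zero>\<^bsub>B.A\<^esub>"
      using pow[of k] arrow_ideal_nilpotent[OF h(1) adm] \<phi>_zero f(2) h(2) by simp
    from B.nilpotent_in_arrow_ideal[OF f(1) this] f(2) show ?thesis by auto
  qed
  obtain f where f: "f \<in> arrow_ideal_pow (brauer_quiver m) 1" "\<phi> (X, \<lambda>_. 0) = B.cls f"
    using rad[OF X] by auto
  obtain h where h: "h \<in> arrow_ideal_pow (brauer_quiver m) 1" "\<phi> (Y, \<lambda>_. 0) = B.cls h"
    using rad[OF Y] by auto
  have XY: "X \<in> carrier A" "Y \<in> carrier A" using X Y by (auto simp: jacobson_rad_def)
  show ?thesis
  proof (rule kdual_separates)
    show "X \<otimes>\<^bsub>A\<^esub> Y \<in> carrier A" using XY by simp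
    fix g assume g: "g \<in> kdual A \<iota>"
    have gT: "(\<zero>\<^bsub>A\<^esub>, g) \<in> carrier T" using g by simp
    have "(\<zero>\<^bsub>A\<^esub>, g) \<otimes>\<^bsub>T\<^esub> (\<zero>\<^bsub>A\<^esub>, g) = \<zero>\<^bsub>T\<^esub>"
      using proj.S.kdual_zero[OF g] by (auto simp: triv_ext_mult)
    then have sq: "\<phi> (\<zero>\<^bsub>A\<^esub>, g) \<otimes>\<^bsub>B.A\<^esub> \<phi> (\<zero>\<^bsub>A\<^esub>, g) = \<zero>\<^bsub>B.A\<^esub>"
      using ring_hom_mult[OF \<phi>_hom gT gT] \<phi>_zero by simp
    have "\<phi> (\<zero>\<^bsub>A\<^esub>, g) \<in> carrier B.A" by (rule ring_hom_closed[OF \<phi>_hom gT])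
    then obtain e where e: "e \<in> carrier B.P" "\<phi> (\<zero>\<^bsub>A\<^esub>, g) = B.cls e"
      by (auto simp: B.carrier_A)
    have "B.cls e [^]\<^bsub>B.A\<^esub> (2::nat) = \<zero>\<^bsub>B.A\<^esub>"
      using sq e by (simp add: numeral_2_eq_2)
    then have e1: "e \<in> arrow_ideal_pow (brauer_quiver m) 1"
      by (rule B.nilpotent_in_arrow_ideal[OF e(1)])
    have fhP: "f \<in> carrier B.P" "h \<in> carrier B.P" using f h by (auto simp: arrow_ideal_pow_def)
    have "f \<otimes>\<^bsub>B.P\<^esub> h \<otimes>\<^bsub>B.P\<^esub> e \<in> arrow_ideal_pow (brauer_quiver m) (1 + 1 + 1)"
      by (intro arrow_ideal_pow_mult f h e1)
    then have "f \<otimes>\<^bsub>B.P\<^esub> h \<otimes>\<^bsub>B.P\<^esub> e \<in> brauer_ideal m"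
      using brauer_rad_cube[OF m] by (auto simp: numeral_3_eq_3)
    then have "B.cls (f \<otimes>\<^bsub>B.P\<^esub> h \<otimes>\<^bsub>B.P\<^esub> e) = \<zero>\<^bsub>B.A\<^esub>"
      using B.cls_eq_zero_iff[of "f \<otimes>\<^bsub>B.P\<^esub> h \<otimes>\<^bsub>B.P\<^esub> e"] fhP e(1) by blast
    then have z: "\<phi> (X, \<lambda>_. 0) \<otimes>\<^bsub>B.A\<^esub> \<phi> (Y, \<lambda>_. 0) \<otimes>\<^bsub>B.A\<^esub> \<phi> (\<zero>\<^bsub>A\<^esub>, g) = \<zero>\<^bsub>B.A\<^esub>"
      using fhP e f(2) h(2) by simp
    have c: "(X, \<lambda>_. 0) \<in> carrier T" "(Y, \<lambda>_. 0) \<in> carrier T" "(X \<otimes>\<^bsub>A\<^esub> Y, \<lambda>_. 0) \<in> carrier T"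
      using XY zero_in_kdual by auto
    have "(X, \<lambda>_. 0) \<otimes>\<^bsub>T\<^esub> (Y, \<lambda>_. 0) = (X \<otimes>\<^bsub>A\<^esub> Y, \<lambda>_. 0)" by simp
    then have "\<phi> ((X \<otimes>\<^bsub>A\<^esub> Y, \<lambda>_. 0) \<otimes>\<^bsub>T\<^esub> (\<zero>\<^bsub>A\<^esub>, g)) = \<phi> \<zero>\<^bsub>T\<^esub>"
      using z \<phi>_zero ring_hom_mult[OF \<phi>_hom c(1,2)] ring_hom_mult[OF \<phi>_hom c(3) gT] by simp
    \<comment> \<open>Injectivity of \<open>\<phi>\<close> is known on the carrier only, so the
      functional sending x to g(x X Y) has to be recognised as a member of the dual.\<close>
    moreover have "(X \<otimes>\<^bsub>A\<^esub> Y, \<lambda>_. 0) \<otimes>\<^bsub>T\<^esub> (\<zero>\<^bsub>A\<^esub>, g) \<in> carrier T"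
    proof -
      have "(\<lambda>x. if x \<in> carrier A then g (x \<otimes>\<^bsub>A\<^esub> (X \<otimes>\<^bsub>A\<^esub> Y)) + 0 else 0) \<in> kdual A \<iota>"
        using g XY proj.hom_closed[OF iota_closed]
        unfolding kdual_def bound_iota_def
        by (auto simp: proj.S.l_distr proj.S.m_assoc)
      then show ?thesis using XY by (simp add: triv_ext_mult)
    qed
    ultimately have "(X \<otimes>\<^bsub>A\<^esub> Y, \<lambda>_. 0) \<otimes>\<^bsub>T\<^esub> (\<zero>\<^bsub>A\<^esub>, g) = \<zero>\<^bsub>T\<^esub>"
      using inj zero_T by (meson inj_onD)
    then have "(if \<one>\<^bsub>A\<^esub> \<in> carrier A then g (\<one>\<^bsub>A\<^esub> \<otimes>\<^bsub>A\<^esub> (X \<otimes>\<^bsub>A\<^esub> Y)) + 0 else 0) = 0"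
      unfolding triv_ext_mult triv_ext_simps prod.inject by meson
    then show "g (X \<otimes>\<^bsub>A\<^esub> Y) = 0" using XY by simp
  qed
qed

lemma sum_in_ideal:
  assumes "finite S" "\<And>i. i \<in> S \<Longrightarrow> g i \<in> I"
  shows "(\<lambda>p. \<Sum>i\<in>S. g i p) \<in> I"
  using assms
proof (induction S rule: finite_induct)
  case empty
  then show ?case using additive_subgroup.zero_closed[OF is_additive_subgroup] by simp
next
  case (insert j S)
  then have "g j \<oplus>\<^bsub>P\<^esub> (\<lambda>p. \<Sum>i\<in>S. g i p) \<in> I"
    by (intro additive_subgroup.a_closed[OF is_additive_subgroup]) auto
  then show ?case using insert by simp
qed

end

section \<open>Trivial extensions of radical square zero cycles\<close>

locale rad_square_zero_cycle = bound_quiver Q I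
  for Q :: "('v, 'a, 'm) quiver_scheme" and I :: "('v \<times> 'a list \<Rightarrow> 'k::field) set" +
  fixes n :: nat and c :: "nat \<Rightarrow> 'v" and e :: "nat \<Rightarrow> 'a"
  assumes n_pos: "n \<ge> 1"
    and I_eq: "I = arrow_ideal_pow Q 2"
    and bij_c: "bij_betw c {0..<n} (verts Q)"
    and bij_e: "bij_betw e {0..<n} (arrs Q)"
    and orientation: "\<And>i. i < n \<Longrightarrow>
      (src Q (e i), tgt Q (e i)) = (c i, c (Suc i mod n)) \<or>
      (src Q (e i), tgt Q (e i)) = (c (Suc i mod n), c i)"
begin

text \<open>For n = 1 the arrow is a loop and meets both alternatives of \<open>orientation\<close>;
  it then counts as forward.\<close>

definition fwd :: "nat \<Rightarrow> bool" where
  "fwd i \<longleftrightarrow> (src Q (e i), tgt Q (e i)) = (c i, c (Suc i mod n))"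

text \<open>The arrow \<open>e i\<close> of \<open>Q\<close> runs from \<open>c (u i)\<close> to \<open>c (w i)\<close> and corresponds to the arrow \<open>x i\<close> of the
  Brauer quiver, whereas the other arrow \<open>y i\<close> between \<open>i\<close> and \<open>i + 1\<close> corresponds to the
  element of the dual basis belonging to \<open>e i\<close>.\<close>

definition x :: "nat \<Rightarrow> bool \<times> nat" where "x i = (fwd i, i)"
definition y :: "nat \<Rightarrow> bool \<times> nat" where "y i = (\<not> fwd i, i)"
definition u :: "nat \<Rightarrow> nat" where "u i = (if fwd i then i else Suc i mod n)"
definition w :: "nat \<Rightarrow> nat" where "w i = (if fwd i then Suc i mod n else i)"

abbreviation N :: "(nat, bool \<times> nat) quiver" where "N \<equiv> brauer_quiver n"
abbreviation PN :: "(nat \<times> (bool \<times> nat) list \<Rightarrow> 'k) ring" where "PN \<equiv> path_alg N"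

lemma Suc_mod_less: "Suc i mod n < n"
  using n_pos by simp

lemma uw_less: "i < n \<Longrightarrow> u i < n" "i < n \<Longrightarrow> w i < n"
  using Suc_mod_less by (auto simp: u_def w_def)

lemma tgt_N [simp]: "tgt N (x i) = w i" "tgt N (y i) = u i"
  by (auto simp: x_def y_def u_def w_def brauer_quiver_def)

lemma ends_e: "i < n \<Longrightarrow> src Q (e i) = c (u i)" "i < n \<Longrightarrow> tgt Q (e i) = c (w i)"
  using orientation[of i] by (auto simp: fwd_def u_def w_def)

lemma c_verts: "i < n \<Longrightarrow> c i \<in> verts Q"
  using bij_c by (auto simp: bij_betw_def)

lemma e_arrs: "i < n \<Longrightarrow> e i \<in> arrs Q"
  using bij_e by (auto simp: bij_betw_def)

lemma verts_cases:
  assumes "v \<in> verts Q" obtains i where "i < n" "v = c i"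
  using assms bij_c unfolding bij_betw_def by (metis atLeastLessThan_iff imageE)

lemma arrs_cases:
  assumes "a \<in> arrs Q" obtains i where "i < n" "a = e i"
  using assms bij_e unfolding bij_betw_def by (metis atLeastLessThan_iff imageE)

section \<open>Coordinates with respect to vertices and arrows\<close>

definition pt :: "('v \<times> 'a list \<Rightarrow> 'k) set \<Rightarrow> nat \<Rightarrow> 'k" where
  "pt X i = rep X (c i, [])"

definition ar :: "('v \<times> 'a list \<Rightarrow> 'k) set \<Rightarrow> nat \<Rightarrow> 'k" where
  "ar X i = rep X (c (u i), [e i])"

lemma short_zero: "f \<in> I \<Longrightarrow> length xs < 2 \<Longrightarrow> f (v, xs) = 0"
  unfolding I_eq arrow_ideal_pow_def by force

lemma I_memI:
  assumes "f \<in> carrier P" "\<And>v xs. f (v, xs) \<noteq> 0 \<Longrightarrow> 2 \<le> length xs"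
  shows "f \<in> I"
  using assms unfolding I_eq by (simp add: arrow_ideal_pow_def)

text \<open>Elements of I have no terms of length below two, so the coefficients at vertices and
  arrows do not depend on the representative. This makes \<open>pt\<close> and \<open>ar\<close>
  genuine coordinates on A.\<close>

lemma rep_short:
  assumes "f \<in> carrier P" "length xs < 2"
  shows "rep (cls f) (v, xs) = f (v, xs)"
  using short_zero[OF rep_cls[OF assms(1)] assms(2)] by simp

lemma coords_cls:
  assumes "f \<in> carrier P"
  shows "pt (cls f) i = f (c i, [])" "ar (cls f) i = f (c (u i), [e i])"
  using rep_short[OF assms] by (simp_all add: pt_def ar_def)

lemma short_path_cases:
  assumes "is_path Q (v, xs)" "length xs < 2"
  obtains i where "i < n" "v = c i" "xs = []" | i where "i < n" "v = c (u i)" "xs = [e i]"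
proof (cases xs)
  case Nil
  then show ?thesis using assms that(1) by (auto elim: verts_cases)
next
  case (Cons a ys)
  then have "xs = [a]" "a \<in> arrs Q" "src Q a = v" using assms by auto
  then show ?thesis using that(2) by (auto elim!: arrs_cases simp: ends_e)
qed

text \<open>Representatives with equal coordinates differ only in paths of length at least two, and
  these span I.\<close>

lemma coords_eqI:
  assumes X: "X \<in> carrier A" and Y: "Y \<in> carrier A"
    and eq: "\<And>i. i < n \<Longrightarrow> pt X i = pt Y i" "\<And>i. i < n \<Longrightarrow> ar X i = ar Y i"
  shows "X = Y"
proof -
  have R: "rep X \<in> carrier P" "rep Y \<in> carrier P" using rep X Y by auto
  have le: "2 \<le> length xs" if nz: "rep X (v, xs) - rep Y (v, xs) \<noteq> 0" for v xs
  proof (rule ccontr)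
    assume short: "\<not> 2 \<le> length xs"
    have "is_path Q (v, xs)"
      using nz R by (cases "rep X (v, xs) = 0") (simp_all add: path_alg_carrier_iff)
    then show False
      using short nz eq by (auto elim: short_path_cases simp: pt_def ar_def not_le)
  qed
  have "(\<lambda>p. rep X p - rep Y p) \<in> carrier P"
    using minus_closed[OF R] unfolding minus_P[OF R] .
  then have "(\<lambda>p. rep X p - rep Y p) \<in> I"
    by (rule I_memI) (rule le)
  then have "cls (rep X) = cls (rep Y)" by (rule iffD2[OF cls_eq_iff[OF R]])
  then show ?thesis
    by (rule box_equals[OF _ conjunct2[OF rep[OF X], symmetric] conjunct2[OF rep[OF Y], symmetric]])
qed

lemma coords_add:
  assumes "X \<in> carrier A" "Y \<in> carrier A"
  shows "pt (X \<oplus>\<^bsub>A\<^esub> Y) i = pt X i + pt Y i" "ar (X \<oplus>\<^bsub>A\<^esub> Y) i = ar X i + ar Y i"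
proof -
  obtain f g where fg: "f \<in> carrier P" "g \<in> carrier P" and XY: "X = cls f" "Y = cls g"
    using assms by (auto simp: carrier_A)
  have s: "X \<oplus>\<^bsub>A\<^esub> Y = cls (\<lambda>p. f p + g p)" using proj.hom_add[OF fg] by (simp add: XY)
  show "pt (X \<oplus>\<^bsub>A\<^esub> Y) i = pt X i + pt Y i" "ar (X \<oplus>\<^bsub>A\<^esub> Y) i = ar X i + ar Y i"
    unfolding s unfolding XY
    by (simp_all only: coords_cls[OF path_alg_add_closed[OF fg]] coords_cls[OF fg(1)] coords_cls[OF fg(2)])
qed

text \<open>The whole multiplication table of A: an arrow splits only into its source followed by
  itself, or itself followed by its target. Equations in A are later checked through it.\<close>

lemma coords_mult:
  assumes "X \<in> carrier A" "Y \<in> carrier A" "i < n"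
  shows "pt (X \<otimes>\<^bsub>A\<^esub> Y) i = pt X i * pt Y i"
    and "ar (X \<otimes>\<^bsub>A\<^esub> Y) i = pt X (u i) * ar Y i + ar X i * pt Y (w i)"
proof -
  obtain f g where fg: "f \<in> carrier P" "g \<in> carrier P" and XY: "X = cls f" "Y = cls g"
    using assms by (auto simp: carrier_A)
  have s: "X \<otimes>\<^bsub>A\<^esub> Y = cls (f \<otimes>\<^bsub>P\<^esub> g)" using proj.hom_mult[OF fg] by (simp add: XY)
  show "pt (X \<otimes>\<^bsub>A\<^esub> Y) i = pt X i * pt Y i"
    "ar (X \<otimes>\<^bsub>A\<^esub> Y) i = pt X (u i) * ar Y i + ar X i * pt Y (w i)"
    unfolding s unfolding XY
    by (simp_all only: coords_cls[OF path_alg_mult_closed[OF fg]] coords_cls[OF fg(1)]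
      coords_cls[OF fg(2)] path_alg_mult_nil[OF fg] path_alg_mult_arrow[OF fg] ends_e[OF assms(3)])
qed

lemma coords_iota: 
  assumes "i < n"
  shows "pt (\<iota> k) i = k" "ar (\<iota> k) i = 0"
  using coords_cls[OF iota_closed, of k i] c_verts[OF assms]
  by (simp_all add: bound_iota_def path_iota_def path_alg_one)

lemma coords_scale:
  assumes "X \<in> carrier A" "i < n"
  shows "pt (\<iota> k \<otimes>\<^bsub>A\<^esub> X) i = k * pt X i" "ar (\<iota> k \<otimes>\<^bsub>A\<^esub> X) i = k * ar X i"
proof -
  have "\<iota> k \<in> carrier A" unfolding bound_iota_def by (rule proj.hom_closed[OF iota_closed])
  then show "pt (\<iota> k \<otimes>\<^bsub>A\<^esub> X) i = k * pt X i" "ar (\<iota> k \<otimes>\<^bsub>A\<^esub> X) i = k * ar X i"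
    using coords_mult[of "\<iota> k" X i] assms coords_iota uw_less by simp_all
qed

lemma coords_one: "i < n \<Longrightarrow> pt \<one>\<^bsub>A\<^esub> i = 1" "i < n \<Longrightarrow> ar \<one>\<^bsub>A\<^esub> i = 0"
  using coords_iota[of i 1] proj.hom_one by (simp_all add: bound_iota_def path_iota_1)

lemma coords_zero: "pt \<zero>\<^bsub>A\<^esub> i = 0" "ar \<zero>\<^bsub>A\<^esub> i = 0"
  using coords_cls[OF zero_fun_closed, of i] proj.hom_zero by simp_all

text \<open>The linear combination of vertices and arrows with prescribed coefficients. The test
  \<open>xs = [hd xs]\<close> says that the list has length one, and \<open>inv_into\<close>
  recovers the index of a vertex or an arrow.\<close>

definition mk_fun :: "(nat \<Rightarrow> 'k) \<Rightarrow> (nat \<Rightarrow> 'k) \<Rightarrow> 'v \<times> 'a list \<Rightarrow> 'k" where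
  "mk_fun p q = (\<lambda>(v, xs).
     if xs = [] \<and> v \<in> verts Q then p (inv_into {0..<n} c v)
     else if xs = [hd xs] \<and> hd xs \<in> arrs Q \<and> src Q (hd xs) = v then q (inv_into {0..<n} e (hd xs))
     else 0)"

lemma mk_fun_closed: "mk_fun p q \<in> carrier P"
proof -
  let ?S = "(\<lambda>v. (v, [])) ` verts Q \<union> (\<lambda>a. (src Q a, [a])) ` arrs Q"
  have "finite (arrs Q)" using bij_e bij_betw_finite by blast
  moreover have "{p'. mk_fun p q p' \<noteq> 0} \<subseteq> ?S"
    by (auto simp: mk_fun_def image_iff split: if_splits)
  ultimately have "finite {p'. mk_fun p q p' \<noteq> 0}"
    using finite_verts by (auto intro: finite_subset)
  moreover have "is_path Q p'" if "p' \<in> ?S" for p'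
    using that by (auto elim!: arrs_cases simp: e_arrs ends_e c_verts uw_less)
  ultimately show ?thesis
    using \<open>{p'. mk_fun p q p' \<noteq> 0} \<subseteq> ?S\<close> unfolding path_alg_carrier_iff by blast
qed

definition mk :: "(nat \<Rightarrow> 'k) \<Rightarrow> (nat \<Rightarrow> 'k) \<Rightarrow> ('v \<times> 'a list \<Rightarrow> 'k) set" where
  "mk p q = cls (mk_fun p q)"

lemma mk_closed: "mk p q \<in> carrier A"
  unfolding mk_def by (rule proj.hom_closed[OF mk_fun_closed])

lemma coords_mk:
  assumes "i < n"
  shows "pt (mk p q) i = p i" "ar (mk p q) i = q i"
proof -
  have inv: "inv_into {0..<n} c (c i) = i" "inv_into {0..<n} e (e i) = i"
    using assms bij_c bij_e by (auto simp: bij_betw_def)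
  show "pt (mk p q) i = p i" "ar (mk p q) i = q i"
    unfolding mk_def coords_cls[OF mk_fun_closed]
    using assms by (simp_all add: mk_fun_def inv c_verts e_arrs ends_e)
qed

section \<open>Functionals in coordinates and the map onto the trivial extension\<close>

abbreviation E :: "nat \<Rightarrow> ('v \<times> 'a list \<Rightarrow> 'k) set" where
  "E j \<equiv> mk (\<lambda>i. if i = j then 1 else 0) (\<lambda>_. 0)"

abbreviation F :: "nat \<Rightarrow> ('v \<times> 'a list \<Rightarrow> 'k) set" where
  "F j \<equiv> mk (\<lambda>_. 0) (\<lambda>i. if i = j then 1 else 0)"

lemma kdual_coords:
  assumes g: "g \<in> kdual A \<iota>" and X: "X \<in> carrier A"
  shows "g X = (\<Sum>i<n. pt X i * g (E i) + ar X i * g (F i))"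
proof -
  \<comment> \<open>Truncations of X after k vertices and k arrows; passing from k to k + 1 adds one
    term of each kind, so additivity of g can be used inductively.\<close>
  define Y where "Y k = mk (\<lambda>i. if i < k then pt X i else 0) (\<lambda>i. if i < k then ar X i else 0)"
    for k :: nat
  have iota: "\<iota> k \<in> carrier A" for k
    unfolding bound_iota_def by (rule proj.hom_closed[OF iota_closed])
  have gadd: "g (X \<oplus>\<^bsub>A\<^esub> Z) = g X + g Z" if "X \<in> carrier A" "Z \<in> carrier A" for X Z
    using g that by (simp add: kdual_def)
  have gscale: "g (\<iota> k \<otimes>\<^bsub>A\<^esub> Z) = k * g Z" if "Z \<in> carrier A" for k Z
    using g that by (simp add: kdual_def)
  have gY: "g (Y k) = (\<Sum>i<k. pt X i * g (E i) + ar X i * g (F i))" if "k \<le> n" for k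
    using that
  proof (induction k)
    case 0
    have "Y 0 = \<zero>\<^bsub>A\<^esub>"
      by (rule coords_eqI) (simp_all add: Y_def mk_closed coords_mk coords_zero)
    then show ?case using proj.S.kdual_zero[OF g] by simp
  next
    case (Suc k)
    let ?D = "\<iota> (pt X k) \<otimes>\<^bsub>A\<^esub> E k \<oplus>\<^bsub>A\<^esub> \<iota> (ar X k) \<otimes>\<^bsub>A\<^esub> F k"
    have D: "?D \<in> carrier A" "\<iota> (pt X k) \<otimes>\<^bsub>A\<^esub> E k \<in> carrier A" "\<iota> (ar X k) \<otimes>\<^bsub>A\<^esub> F k \<in> carrier A"
      by (simp_all add: iota mk_closed)
    have Yk: "Y k \<in> carrier A" by (simp add: Y_def mk_closed)
    have "Y (Suc k) = Y k \<oplus>\<^bsub>A\<^esub> ?D"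
    proof (rule coords_eqI)
      show "Y (Suc k) \<in> carrier A" by (simp add: Y_def mk_closed)
      show "Y k \<oplus>\<^bsub>A\<^esub> ?D \<in> carrier A" using D Yk by simp
      fix i assume "i < n"
      then show "pt (Y (Suc k)) i = pt (Y k \<oplus>\<^bsub>A\<^esub> ?D) i" "ar (Y (Suc k)) i = ar (Y k \<oplus>\<^bsub>A\<^esub> ?D) i"
        unfolding coords_add[OF Yk D(1)] coords_add[OF D(2,3)]
        by (auto simp: Y_def coords_mk coords_scale mk_closed less_Suc_eq)
    qed
    then show ?case
      using Suc by (simp add: gadd[OF Yk D(1)] gadd[OF D(2,3)] gscale[OF mk_closed])
  qed
  have "Y n = X"
    by (rule coords_eqI) (simp_all add: Y_def mk_closed coords_mk X)
  then show ?thesis using gY[OF order_refl] by simp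
qed

text \<open>Dual part of the image of f: both cycles along edge i are sent to the dual vectors of
  their base points \<open>u i\<close> and \<open>w i\<close>, and \<open>y i\<close> to the dual
  vector of \<open>e i\<close>. All other paths of length at least two contribute nothing.\<close>

definition G :: "(nat \<times> (bool \<times> nat) list \<Rightarrow> 'k) \<Rightarrow> ('v \<times> 'a list \<Rightarrow> 'k) set \<Rightarrow> 'k" where
  "G f X = (if X \<in> carrier A then
     (\<Sum>i<n. f (u i, [x i, y i]) * pt X (u i) + f (w i, [y i, x i]) * pt X (w i)
        + f (w i, [y i]) * ar X i) else 0)"

definition B :: "(nat \<times> (bool \<times> nat) list \<Rightarrow> 'k) \<Rightarrow> ('v \<times> 'a list \<Rightarrow> 'k) set" where
  "B f = mk (\<lambda>i. f (i, [])) (\<lambda>i. f (u i, [x i]))"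

definition \<Psi> where "\<Psi> f = (B f, G f)"

lemma G_kdual: "G f \<in> kdual A \<iota>"
  unfolding kdual_def
proof (intro CollectI conjI ballI allI impI)
  fix X Y assume "X \<in> carrier A" "Y \<in> carrier A"
  then show "G f (X \<oplus>\<^bsub>A\<^esub> Y) = G f X + G f Y"
    by (simp add: G_def coords_add uw_less algebra_simps sum.distrib)
next
  fix k X assume X: "X \<in> carrier A"
  then have "\<iota> k \<otimes>\<^bsub>A\<^esub> X \<in> carrier A"
    using proj.hom_closed[OF iota_closed, of k] by (simp add: bound_iota_def)
  then show "G f (\<iota> k \<otimes>\<^bsub>A\<^esub> X) = k * G f X"
    using X unfolding G_def
    by (simp add: sum_distrib_left, intro sum.cong)
      (auto simp: coords_scale uw_less algebra_simps)
qed (simp add: G_def)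

lemma \<Psi>_hom: "\<Psi> \<in> ring_hom PN T"
proof (rule ring_hom_memI)
  fix f g assume fg: "f \<in> carrier PN" "g \<in> carrier PN"
  show "\<Psi> f \<in> carrier T" by (simp add: \<Psi>_def B_def mk_closed G_kdual)
  have Bc: "B f \<in> carrier A" "B g \<in> carrier A" by (simp_all add: B_def mk_closed)
  show "\<Psi> (f \<oplus>\<^bsub>PN\<^esub> g) = \<Psi> f \<oplus>\<^bsub>T\<^esub> \<Psi> g"
  proof -
    have "B (f \<oplus>\<^bsub>PN\<^esub> g) = B f \<oplus>\<^bsub>A\<^esub> B g"
      by (rule coords_eqI) (simp_all add: B_def coords_add coords_mk mk_closed)
    moreover have "G (f \<oplus>\<^bsub>PN\<^esub> g) = (\<lambda>X. G f X + G g X)"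
      by (auto simp: G_def algebra_simps sum.distrib)
    ultimately show ?thesis by (simp add: \<Psi>_def)
  qed
  show "\<Psi> (f \<otimes>\<^bsub>PN\<^esub> g) = \<Psi> f \<otimes>\<^bsub>T\<^esub> \<Psi> g"
  proof -
    have "B (f \<otimes>\<^bsub>PN\<^esub> g) = B f \<otimes>\<^bsub>A\<^esub> B g"
      by (rule coords_eqI)
        (simp_all add: B_def coords_mult coords_mk mk_closed uw_less
          path_alg_mult_nil[OF fg] path_alg_mult_arrow[OF fg])
    moreover have "G (f \<otimes>\<^bsub>PN\<^esub> g) X = (if X \<in> carrier A then G g (X \<otimes>\<^bsub>A\<^esub> B f) + G f (B g \<otimes>\<^bsub>A\<^esub> X) else 0)" for X
    proof (cases "X \<in> carrier A")
      case True
      then have c: "X \<otimes>\<^bsub>A\<^esub> B f \<in> carrier A" "B g \<otimes>\<^bsub>A\<^esub> X \<in> carrier A" using Bc by simp_all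
      have BB: "pt (B h) i = h (i, [])" "ar (B h) i = h (u i, [x i])" if "i < n" for h i
        using that by (simp_all add: B_def coords_mk)
      \<comment> \<open>The identity holds edge by edge. The mixed products, \<open>x i\<close> from
        f with \<open>y i\<close> from g and \<open>y i\<close> from f with \<open>x i\<close> from
        g, come from the arrow coordinates of X times \<open>B f\<close> and of \<open>B g\<close>
        times X.\<close>
      show ?thesis
        using True c unfolding G_def
        by (simp add: sum.distrib[symmetric], intro sum.cong refl)
          (simp add: coords_mult True Bc BB uw_less path_alg_mult_arrow[OF fg]
            path_alg_mult_arrow2[OF fg] algebra_simps)
    qed (simp add: G_def)
    ultimately show ?thesis by (simp add: \<Psi>_def triv_ext_mult fun_eq_iff)
  qed
next
  have "B \<one>\<^bsub>PN\<^esub> = \<one>\<^bsub>A\<^esub>"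
    by (rule coords_eqI) (simp_all add: B_def coords_one coords_mk mk_closed path_alg_one)
  moreover have "G \<one>\<^bsub>PN\<^esub> = (\<lambda>_. 0)"
    by (auto simp: G_def path_alg_one)
  ultimately show "\<Psi> \<one>\<^bsub>PN\<^esub> = \<one>\<^bsub>T\<^esub>" by (simp add: \<Psi>_def)
qed


lemma \<Psi>_surj: "\<Psi> ` carrier PN = carrier T"
proof
  show "\<Psi> ` carrier PN \<subseteq> carrier T" using ring_hom_closed[OF \<Psi>_hom] by blast
  show "carrier T \<subseteq> \<Psi> ` carrier PN"
  proof
    fix t assume "t \<in> carrier T"
    then obtain X g where t: "t = (X, g)" and X: "X \<in> carrier A" and g: "g \<in> kdual A \<iota>"
      by (cases t) auto
    \<comment> \<open>Each vertex i is the value of two cycles. The coefficient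
      \<open>g (E i)\<close> is put on alpha_i beta_i only, the cycle whose edge index equals its
      base point, so it is counted once.\<close>
    define f :: "nat \<times> (bool \<times> nat) list \<Rightarrow> 'k" where
      "f p = (if is_path N p then
         (case snd p of
            [] \<Rightarrow> pt X (fst p)
          | [(b, i)] \<Rightarrow> if b = fwd i then ar X i else g (F i)
          | [(b, i), (b', j)] \<Rightarrow> if b \<and> \<not> b' then g (E i) else 0
          | _ \<Rightarrow> 0) else 0)" for p
    have f: "f \<in> carrier PN"
    proof -
      have verts: "is_path N (v, xs) \<Longrightarrow> v < n \<and> set xs \<subseteq> UNIV \<times> {0..<n}" for v xs
        by (induction xs arbitrary: v) (auto simp: brauer_quiver_def)
      have f_path: "is_path N p" if "f p \<noteq> 0" for p
        using that by (rule contrapos_np) (simp add: f_def)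
      have f_long: "f (v, a # b # d # zs) = 0" for v a b d zs
        by (cases a; cases b; cases d) (simp add: f_def)
      have f_short: "length zs \<le> 2" if "f (v, zs) \<noteq> 0" for v zs
      proof (rule ccontr)
        assume "\<not> length zs \<le> 2"
        then have "Suc (Suc (Suc 0)) \<le> length zs" by simp
        then obtain a b d zs' where "zs = a # b # d # zs'"
          by (auto simp: Suc_le_length_iff)
        then show False using that f_long by simp
      qed
      have "{p. f p \<noteq> 0} \<subseteq> {0..<n} \<times> {xs. set xs \<subseteq> UNIV \<times> {0..<n} \<and> length xs \<le> 2}"
        using verts f_path f_short by force
      moreover have "finite ({0..<n} \<times> {xs. set xs \<subseteq> (UNIV :: bool set) \<times> {0..<n} \<and> length xs \<le> 2})"
        by (intro finite_cartesian_product finite_lists_length_le) auto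
      ultimately have "finite {p. f p \<noteq> 0}" by (rule finite_subset)
      then show ?thesis using f_path unfolding path_alg_carrier_iff by blast
    qed
    have f_vals: "f (i, []) = pt X i" "f (u i, [x i]) = ar X i" "f (w i, [y i]) = g (F i)"
      "f (u i, [x i, y i]) = (if fwd i then g (E i) else 0)"
      "f (w i, [y i, x i]) = (if fwd i then 0 else g (E i))" if "i < n" for i
      using that Suc_mod_less[of i] by (auto simp: f_def x_def y_def u_def w_def)
    have "B f = X"
      by (rule coords_eqI) (simp_all add: B_def mk_closed coords_mk X f_vals)
    moreover have "G f Z = g Z" for Z
    proof (cases "Z \<in> carrier A")
      case True
      show ?thesis
        unfolding kdual_coords[OF g True] G_def if_P[OF True]
      proof (rule sum.cong[OF refl])
        fix i assume "i \<in> {..<n}"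
        then have i: "i < n" by simp
        show "f (u i, [x i, y i]) * pt Z (u i) + f (w i, [y i, x i]) * pt Z (w i)
            + f (w i, [y i]) * ar Z i = pt Z i * g (E i) + ar Z i * g (F i)"
          unfolding f_vals[OF i] by (simp add: u_def w_def)
      qed
    next
      case False
      then show ?thesis using g by (simp add: G_def kdual_def)
    qed
    ultimately have "\<Psi> f = t" by (auto simp: \<Psi>_def t)
    then show "t \<in> \<Psi> ` carrier PN" using f by auto
  qed
qed

text \<open>T inherits the ring axioms as the image of a path algebra. The library's image ring
  replaces carrier and zero by the image and by the image of zero, and surjectivity identifies the
  result with T itself.\<close>

lemma T_ring: "ring T"
proof -
  interpret PN: ring PN by (rule path_alg_ring) simp
  have \<Psi>0: "\<Psi> \<zero>\<^bsub>PN\<^esub> = \<zero>\<^bsub>T\<^esub>"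
  proof -
    have "B \<zero>\<^bsub>PN\<^esub> = \<zero>\<^bsub>A\<^esub>"
      by (rule coords_eqI) (simp_all add: B_def mk_closed coords_mk coords_zero)
    then show ?thesis by (auto simp: \<Psi>_def G_def)
  qed
  have T_eq: "T\<lparr>carrier := carrier T, zero := \<zero>\<^bsub>T\<^esub>\<rparr> = T"
    by (simp add: triv_ext_def)
  from PN.ring_hom_imp_img_ring[OF \<Psi>_hom] show ?thesis
    unfolding \<Psi>_surj \<Psi>0 T_eq .
qed

section \<open>The kernel and the resulting isomorphism\<close>

lemma brauer_path_kinds:
  assumes "is_path N (v, xs)" "length xs \<ge> 2"
  obtains "path_basis (v, xs) \<in> (brauer_ideal n :: (nat \<times> (bool \<times> nat) list \<Rightarrow> 'k) set)"
  | i where "i < n" "v = i" "xs = [(True, i), (False, i)]"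
  | i where "i < n" "v = Suc i mod n" "xs = [(False, i), (True, i)]"
proof (cases "length xs \<ge> 3")
  case True
  then show ?thesis using brauer_long_paths[OF n_pos assms(1)] that(1) by blast
next
  case False
  then have "length xs = 2" using assms by simp
  then obtain a b where "xs = [a, b]" by (auto simp: numeral_2_eq_2 length_Suc_conv)
  then obtain p i q j where xs: "xs = [(p, i), (q, j)]" by (cases a, cases b) auto
  consider "p = q" | "p = True" "q = False" | "p = False" "q = True" by (cases p; cases q) auto
  then show ?thesis
  proof cases
    case 1
    then show ?thesis
      using that(1) brauer_monomial_relations[OF n_pos, of v p i j] assms(1) xs by blast
  next
    case 2
    then have "i < n" "j < n" "v = i" "Suc i mod n = Suc j mod n" using assms(1) xs by auto
    moreover from this have "j = i" using Suc_mod_inj by blast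
    ultimately show ?thesis using that(2) xs 2 by blast
  next
    case 3
    then have "i < n" "v = Suc i mod n" "j = i" using assms(1) xs by auto
    then show ?thesis using that(3) xs 3 by blast
  qed
qed

text \<open>That the relations die is a computation. Conversely, a kernel element has no short
  terms, and at each vertex the coefficients of the two cycles cancel; it is therefore a combination
  of commutativity relations up to paths that lie in the ideal anyway.\<close>

lemma \<Psi>_kernel: "a_kernel PN T \<Psi> = brauer_ideal n"
proof
  interpret \<Psi>: ring_hom_ring PN T \<Psi>
    using \<Psi>_hom T_ring path_alg_ring[of N] by (intro ring_hom_ringI2) auto
  interpret BN: bound_quiver N "brauer_ideal n :: (nat \<times> (bool \<times> nat) list \<Rightarrow> 'k) set"
    by (rule bound_quiver_brauer[OF n_pos])
  have zero_iff: "f \<in> a_kernel PN T \<Psi> \<longleftrightarrow> f \<in> carrier PN \<and> B f = \<zero>\<^bsub>A\<^esub> \<and> G f = (\<lambda>_. 0)" for f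
    by (auto simp: a_kernel_def' \<Psi>_def)
  show "brauer_ideal n \<subseteq> a_kernel PN T \<Psi>"
    unfolding brauer_ideal_def
  proof (rule \<Psi>.R.genideal_minimal[OF \<Psi>.kernel_is_ideal], rule subsetI)
    fix r :: "nat \<times> (bool \<times> nat) list \<Rightarrow> 'k" assume r: "r \<in> brauer_rels n"
    then have r2: "r \<in> arrow_ideal_pow N 2" using brauer_rels_closed[OF n_pos] by auto
    then have short: "r (v, xs) = 0" if "length xs < 2" for v xs
      using that unfolding arrow_ideal_pow_def by force
    have "B r = \<zero>\<^bsub>A\<^esub>"
      by (rule coords_eqI) (simp_all add: B_def mk_closed coords_mk coords_zero short)
    moreover have "G r X = 0" if "X \<in> carrier A" for X
    proof -
      obtain i where i: "i < n" and kinds: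
        "r = path_basis (i, [(True, i), (True, Suc i mod n)]) \<or>
         r = path_basis (Suc (Suc i mod n) mod n, [(False, Suc i mod n), (False, i)]) \<or>
         r = (\<lambda>p. path_basis (Suc i mod n, [(False, i), (True, i)]) p
            - path_basis (Suc i mod n, [(True, Suc i mod n), (False, Suc i mod n)]) p)"
        using r unfolding brauer_rels_def Let_def by auto
      define k where "k = Suc i mod n"
      have k: "k < n" using Suc_mod_less by (simp add: k_def)
      let ?z = "\<lambda>j. r (u j, [x j, y j]) * pt X (u j) + r (w j, [y j, x j]) * pt X (w j)"
      \<comment> \<open>Reversing an edge merely swaps the two terms, so each summand can be written
        without reference to the orientation.\<close>
      have z: "?z j = r (j, [(True, j), (False, j)]) * pt X j
          + r (Suc j mod n, [(False, j), (True, j)]) * pt X (Suc j mod n)" for j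
        by (simp add: u_def w_def x_def y_def add.commute)
      have "(\<Sum>j<n. ?z j) = 0"
      proof -
        consider (TT) "r = path_basis (i, [(True, i), (True, k)])"
          | (FF) "r = path_basis (Suc k mod n, [(False, k), (False, i)])"
          | (comm) "r = (\<lambda>p. path_basis (k, [(False, i), (True, i)]) p
              - path_basis (k, [(True, k), (False, k)]) p)"
          using kinds unfolding k_def by blast
        then show ?thesis
        proof cases
          case TT
          have "?z j = 0" for j unfolding z unfolding TT by (simp add: path_basis_def)
          then show ?thesis by simp
        next
          case FF
          have "?z j = 0" for j unfolding z unfolding FF by (simp add: path_basis_def)
          then show ?thesis by simp
        next
          case comm
          \<comment> \<open>The commutativity relation at vertex k contributes +1 along edge i and
            -1 along edge k, both evaluated at k. For n = 1 they cancel within a single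
            summand.\<close>
          have "?z j = (if j = i then pt X k else 0) - (if j = k then pt X k else 0)" for j
            unfolding z unfolding comm by (auto simp: path_basis_def k_def)
          then show ?thesis using i k by (simp add: sum_subtractf)
        qed
      qed
      then show ?thesis using that by (simp add: G_def short)
    qed
    then have "G r = (\<lambda>_. 0)" by (auto simp: G_def)
    ultimately show "r \<in> a_kernel PN T \<Psi>"
      using r2 by (simp add: zero_iff arrow_ideal_pow_def)
  qed
  show "a_kernel PN T \<Psi> \<subseteq> brauer_ideal n"
  proof
    fix f assume "f \<in> a_kernel PN T \<Psi>"
    then have f: "f \<in> carrier PN" and Bf: "B f = \<zero>\<^bsub>A\<^esub>" and Gf: "G f = (\<lambda>_. 0)"
      by (simp_all add: zero_iff)
    have f0: "f (i, []) = 0" "f (u i, [x i]) = 0" if "i < n" for i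
      using that coords_mk[of i "\<lambda>i. f (i, [])" "\<lambda>i. f (u i, [x i])"] Bf coords_zero[of i]
      by (simp_all add: B_def)
    have f1: "f (w j, [y j]) = 0" if "j < n" for j
    proof -
      have "G f (F j) = (\<Sum>i<n. if i = j then f (w i, [y i]) else 0)"
        unfolding G_def if_P[OF mk_closed] by (rule sum.cong) (auto simp: coords_mk uw_less)
      then show ?thesis using Gf that by simp
    qed
    let ?s = "\<lambda>j. Suc j mod n"
    \<comment> \<open>Evaluation at \<open>E j\<close> collects both cycles based at vertex j. The
      predecessor of j mod n appears only implicitly, as the index i with successor j.\<close>
    have f2: "f (j, [(True, j), (False, j)])
        + (\<Sum>i<n. if ?s i = j then f (?s i, [(False, i), (True, i)]) else 0) = 0" if "j < n" for j
    proof -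
      have "G f (E j) = (\<Sum>i<n. (if i = j then f (i, [(True, i), (False, i)]) else 0)
          + (if ?s i = j then f (?s i, [(False, i), (True, i)]) else 0))"
        unfolding G_def if_P[OF mk_closed]
        by (rule sum.cong) (auto simp: coords_mk Suc_mod_less u_def w_def x_def y_def)
      then show ?thesis using Gf that by (simp add: sum.distrib)
    qed
    \<comment> \<open>The combination \<open>d\<close> of these relations is chosen to agree with f
      on all cycles beta_i alpha_i; agreement on the cycles alpha_j beta_j is then forced by
      \<open>f2\<close>. Hence f - \<open>d\<close> involves only paths from the ideal.\<close>
    define r :: "nat \<Rightarrow> nat \<times> (bool \<times> nat) list \<Rightarrow> 'k" where
      "r i = (\<lambda>p. path_basis (?s i, [(False, i), (True, i)]) p
         - path_basis (?s i, [(True, ?s i), (False, ?s i)]) p)" for i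
    define d where "d = (\<lambda>p. \<Sum>i\<in>{..<n}. f (?s i, [(False, i), (True, i)]) * r i p)"
    have d: "d \<in> brauer_ideal n"
      unfolding d_def r_def
      by (intro BN.sum_in_ideal BN.scale_relation brauer_relations[OF n_pos]) auto
    have dP: "d \<in> carrier PN" using d BN.a_subset by auto
    have h: "(\<lambda>p. f p - d p) \<in> brauer_ideal n"
    proof (rule BN.combination_in_ideal)
      show hP: "(\<lambda>p. f p - d p) \<in> carrier PN"
        using \<Psi>.R.minus_closed[OF f dP] unfolding BN.minus_P[OF f dP] .
      have d_short: "d (v, xs) = 0" if "length xs < 2" for v xs
        using that by (auto simp: d_def r_def path_basis_def intro!: sum.neutral)
      have d_FT: "d (?s j, [(False, j), (True, j)]) = f (?s j, [(False, j), (True, j)])" if "j < n" for j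
      proof -
        have "d (?s j, [(False, j), (True, j)])
            = (\<Sum>i<n. if i = j then f (?s i, [(False, i), (True, i)]) else 0)"
          unfolding d_def by (rule sum.cong) (auto simp: r_def path_basis_def)
        then show ?thesis using that by simp
      qed
      have d_TF: "d (j, [(True, j), (False, j)]) = f (j, [(True, j), (False, j)])" if "j < n" for j
      proof -
        have "d (j, [(True, j), (False, j)])
            = - (\<Sum>i<n. if ?s i = j then f (?s i, [(False, i), (True, i)]) else 0)"
          unfolding d_def sum_negf[symmetric] by (rule sum.cong) (auto simp: r_def path_basis_def)
        also have "\<dots> = f (j, [(True, j), (False, j)])"
          using f2[OF that] by (simp add: neg_eq_iff_add_eq_0 add.commute)
        finally show ?thesis .
      qed
      fix p assume nz: "f p - d p \<noteq> 0"
      obtain v xs where p: "p = (v, xs)" by (cases p)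
      have path: "is_path N (v, xs)" using hP nz by (simp add: p path_alg_carrier_iff)
      have len: "length xs \<ge> 2"
      proof (rule ccontr)
        assume short: "\<not> length xs \<ge> 2"
        then have fnz: "f (v, xs) \<noteq> 0" using nz d_short[of xs v] by (simp add: p)
        show False
        proof (cases xs)
          case Nil
          then show ?thesis using fnz path f0 by auto
        next
          case (Cons a ys)
          then have xs: "xs = [a]" using short by (cases ys) auto
          obtain b i where a: "a = (b, i)" by (cases a)
          have "i < n" "v = src N (b, i)" using path by (auto simp: xs a)
          then show ?thesis
            using fnz f0(2)[of i] f1[of i]
            by (cases b; cases "fwd i") (auto simp: xs a u_def w_def x_def y_def)
        qed
      qed
      show "path_basis p \<in> (brauer_ideal n :: (nat \<times> (bool \<times> nat) list \<Rightarrow> 'k) set)"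
        using nz d_FT d_TF unfolding p by (cases rule: brauer_path_kinds[OF path len]) auto
    qed
    show "f \<in> brauer_ideal n" by (rule BN.diff_in_ideal[OF h d f])
  qed
qed

theorem triv_ext_brauer: "is_brauer_cycle_alg T (triv_ext_iota \<iota>)"
proof -
  interpret \<Psi>: ring_hom_ring PN T \<Psi>
    using \<Psi>_hom T_ring path_alg_ring[of N] by (intro ring_hom_ringI2) auto
  interpret BN: bound_quiver N "brauer_ideal n :: (nat \<times> (bool \<times> nat) list \<Rightarrow> 'k) set"
    by (rule bound_quiver_brauer[OF n_pos])
  let ?\<theta> = "\<lambda>X. the_elem (\<Psi> ` X)"
  have iso: "?\<theta> \<in> ring_iso BN.A T"
    using \<Psi>.FactRing_iso_set[OF \<Psi>_surj] unfolding \<Psi>_kernel by (simp only: bound_alg_def)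
  \<comment> \<open>The first isomorphism theorem yields a map into T, whereas
    \<open>alg_iso\<close> asks for one out of T. Compatibility of the inverse with scalars is
    checked by applying the original map to the scalars of the Brauer cycle algebra.\<close>
  have inv: "inv_into (carrier BN.A) ?\<theta> \<in> ring_iso T BN.A"
    by (rule ring_iso_set_sym[OF BN.proj.S.ring_axioms iso])
  have inj: "inj_on ?\<theta> (carrier BN.A)"
    using iso by (simp add: ring_iso_def bij_betw_def)
  have "inv_into (carrier BN.A) ?\<theta> (triv_ext_iota \<iota> k) = brauer_cycle_iota n k" for k
  proof -
    have "B (path_iota N k) = \<iota> k"
    proof (rule coords_eqI)
      show "\<iota> k \<in> carrier A" unfolding bound_iota_def by (rule proj.hom_closed[OF iota_closed])
    qed (simp_all add: B_def mk_closed coords_mk coords_iota path_iota_def path_alg_one)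
    moreover have "G (path_iota N k) = (\<lambda>_. 0)"
      by (auto simp: G_def path_iota_def path_alg_one)
    ultimately have "\<Psi> (path_iota N k) = triv_ext_iota \<iota> k"
      by (simp add: \<Psi>_def triv_ext_iota_def)
    moreover have "?\<theta> (BN.\<iota> k) = \<Psi> (path_iota N k)"
      using \<Psi>.the_elem_simp[OF BN.iota_closed] unfolding \<Psi>_kernel bound_iota_def .
    moreover have "BN.\<iota> k \<in> carrier BN.A"
      unfolding bound_iota_def by (rule BN.proj.hom_closed[OF BN.iota_closed])
    ultimately show ?thesis
      using inv_into_f_f[OF inj, of "BN.\<iota> k"] by (simp add: brauer_cycle_iota_def)
  qed
  then show ?thesis
    unfolding is_brauer_cycle_alg_def alg_iso_def brauer_cycle_alg_def using inv n_pos by blast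
qed

end

theorem theorem3p10:
  fixes Q :: "('v, 'a) quiver" and I :: "('v \<times> 'a list \<Rightarrow> 'k::field) set" and n :: nat
  assumes "alg_closed TYPE('k)"
    and "n \<ge> 1"
    and "cycle_quiver Q n"
    and "gentle Q I"
  shows "is_brauer_cycle_alg (triv_ext (bound_alg Q I) (bound_iota Q I))
                             (triv_ext_iota (bound_iota Q I))
         \<longleftrightarrow> (\<forall>x\<in>jacobson_rad (bound_alg Q I). \<forall>y\<in>jacobson_rad (bound_alg Q I).
                 x \<otimes>\<^bsub>bound_alg Q I\<^esub> y = \<zero>\<^bsub>bound_alg Q I\<^esub>)"
proof -
  have fin: "finite (verts Q)" and adm: "admissible Q I"
    using assms(4) by (auto simp: gentle_def)
  then obtain m where idl: "ideal I (path_alg Q)" and I2: "I \<subseteq> arrow_ideal_pow Q 2"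
    and m: "arrow_ideal_pow Q m \<subseteq> I"
    by (auto simp: admissible_def)
  interpret bound_quiver Q I
    using idl fin I2 arrow_ideal_pow_mono[of 1 2 Q]
    by (intro bound_quiver.intro bound_quiver_axioms.intro) auto
  show ?thesis
  proof
    assume "is_brauer_cycle_alg T (triv_ext_iota \<iota>)"
    then show "\<forall>x\<in>jacobson_rad A. \<forall>y\<in>jacobson_rad A. x \<otimes>\<^bsub>A\<^esub> y = \<zero>\<^bsub>A\<^esub>"
      using rad_square_zero_if_brauer m by blast
  next
    assume rad: "\<forall>x\<in>jacobson_rad A. \<forall>y\<in>jacobson_rad A. x \<otimes>\<^bsub>A\<^esub> y = \<zero>\<^bsub>A\<^esub>"
    \<comment> \<open>A path of length at least two is an arrow followed by a path of positive
      length. Both factors have classes in the radical, so the product vanishes in A and the path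
      lies in I.\<close>
    have "arrow_ideal_pow Q 2 \<subseteq> I"
    proof
      fix f :: "'v \<times> 'a list \<Rightarrow> 'k" assume f: "f \<in> arrow_ideal_pow Q 2"
      show "f \<in> I"
      proof (rule combination_in_ideal)
        show "f \<in> carrier P" using f by (simp add: arrow_ideal_pow_def)
        fix p assume nz: "f p \<noteq> 0"
        obtain v xs where p: "p = (v, xs)" by (cases p)
        have path: "is_path Q (v, xs)" and len: "length xs \<ge> 2"
          using f nz by (auto simp: p arrow_ideal_pow_def path_alg_carrier_iff)
        from len obtain a ys where xs: "xs = [a] @ ys" and ys: "length ys \<ge> 1"
          by (cases xs) auto
        have paths: "is_path Q (v, [a])" "is_path Q (path_end Q (v, [a]), ys)"
          using path unfolding xs is_path_append by auto
        have arr: "path_basis (v, [a]) \<in> arrow_ideal_pow Q 1"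
          "path_basis (path_end Q (v, [a]), ys) \<in> arrow_ideal_pow Q 1"
          using paths ys by (auto intro!: path_basis_in_arrow_ideal_pow)
        have "cls (path_basis (v, [a])) \<otimes>\<^bsub>A\<^esub> cls (path_basis (path_end Q (v, [a]), ys)) = \<zero>\<^bsub>A\<^esub>"
          using rad arrow_ideal_subset_jacobson_rad[OF _ m] arr by blast
        then have "cls (path_basis (v, [a]) \<otimes>\<^bsub>P\<^esub> path_basis (path_end Q (v, [a]), ys)) = \<zero>\<^bsub>A\<^esub>"
          using proj.hom_mult[OF path_basis_closed[OF paths(1)] path_basis_closed[OF paths(2)]]
          by simp
        then have "cls (path_basis (v, xs)) = \<zero>\<^bsub>A\<^esub>"
          unfolding path_basis_mult[OF path[unfolded xs]] xs[symmetric] .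
        then show "path_basis p \<in> I"
          using cls_eq_zero_iff[OF path_basis_closed[OF path]] by (simp add: p)
      qed
    qed
    with I2 have I_eq: "I = arrow_ideal_pow Q 2" by auto
    obtain c e where "bij_betw c {0..<n} (verts Q)" "bij_betw e {0..<n} (arrs Q)"
      "\<And>i. i < n \<Longrightarrow> (src Q (e i), tgt Q (e i)) = (c i, c (Suc i mod n)) \<or>
         (src Q (e i), tgt Q (e i)) = (c (Suc i mod n), c i)"
      using assms(3) unfolding cycle_quiver_def by blast
    then interpret rad_square_zero_cycle Q I n c e
      using assms(2) I_eq by unfold_locales auto
    show "is_brauer_cycle_alg T (triv_ext_iota \<iota>)" by (rule triv_ext_brauer)
  qed
qed

end
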